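(* Let $X=\{1<2<\cdots<n\}$, let $Y=\{a_1<a_2<\cdots<a_m\}\subseteq X$ with $1<m\le n$, and let $B\subseteq\mathcal{T}(X,Y)$. Then $B$ is a minimal relative generating set of $\mathcal{T}(X,Y)$ modulo $\mathcal{OP}(X,Y)$ if and only if there is a set $\widetilde{B}\subseteq B$ such that the following three statements are satisfied: (i) $\mathcal{R}_m\subseteq\{\ker\beta:\beta\in B\setminus\widetilde{B}\}$; (ii) $|B\setminus\widetilde{B}|=|\mathcal{R}_m|$; (iii) $\mathcal{S}(Y)\subseteq\langle\{\beta|_Y:\beta\in B\},\eta|_Y\rangle$ but $\mathcal{S}(Y)\nsubseteq\langle\{\beta|_Y:\beta\in B\setminus\{\gamma\}\},\eta|_Y\rangle$ for any $\gamma\in B$ with $\ker\gamma\in\{\ker\beta:\beta\in\widetilde{B}\}$.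
   Context: $\mathcal{T}(X)$ is the semigroup of all maps $X\to X$, written on the right and composed left to right. $\mathcal{T}(X,Y)=\{\alpha\in\mathcal{T}(X): X\alpha\subseteq Y\}$. A map $\alpha\in\mathcal{T}(X)$ is orientation-preserving if there are subsets $X_1,X_2\subseteq X$ with $X=X_1\cup X_2$, $X_1\neq\emptyset$ ($X_2$ may be empty), $X_1<X_2$ (i.e. $x_1<x_2$ for all $x_1\in X_1$, $x_2\in X_2$), such that $x\alpha\le y\alpha$ whenever either $(x,y)\in X_1^2\cup X_2^2$ with $x\le y$, or $(x,y)\in X_2\times X_1$. $\mathcal{OP}(X,Y)$ is the semigroup of all orientation-preserving transformations in $\mathcal{T}(X,Y)$. $\langle\,\cdot\,\rangle$ denotes the generated subsemigroup. A relative generating set of a semigroup $S$ modulo $A\subseteq S$ is a set $B\subseteq S$ with $\langle A\cup B\rangle=S$; it is minimal if no proper subset of $B$ is a relative generating set of $S$ modulo $A$ (minimality with respect to inclusion). $\ker\alpha$ is regarded as the partition of $X$ into the nonempty sets $x\alpha^{-1}=\{y\in X: y\alpha=x\}$, $x\in X\alpha$. A set $A\subseteq X$ is convex if $x<y<z$ with $x,z\in A$ implies $y\in A$. $\mathcal{Q}_m$ is the set of all partitions $\{A_1,\dots,A_m\}$ of $X$ into convex sets $A_1<A_2<\cdots<A_m$. $\mathcal{P}_m$ is the set of all partitions $\{A_1,\dots,A_m\}$ of $X$ such that $A_2<A_3<\cdots<A_m$ are convex and $A_1$ is the union of two convex sets with $1,n\in A_1$. $\mathcal{R}_m$ is the set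 of all partitions of $X$ into $m$ blocks that do not belong to $\mathcal{Q}_m\cup\mathcal{P}_m$. $\mathcal{S}(Y)$ is the set of all permutations of $Y$. For $\beta\in\mathcal{T}(X,Y)$, $\beta|_Y:Y\to Y$ is the restriction. $\eta|_Y$ denotes the cyclic permutation of $Y$ given by $a_i\mapsto a_{i+1}$ for $1\le i<m$ and $a_m\mapsto a_1$ (it is the restriction to $Y$ of a fixed $\eta\in\mathcal{OP}(X,Y)$; only the restriction is used here). *)

theory Defs
  imports Complex_Main "HOL-Library.FuncSet" "HOL-Library.Disjoint_Sets"
begin

(* Self-maps of a carrier A are extensional functions, i.e. elements of A \<rightarrow>\<^sub>E A. *)

definition full_trans :: "'a set \<Rightarrow> ('a \<Rightarrow> 'a) set" where
  "full_trans X = X \<rightarrow>\<^sub>E X"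

definition trans_into :: "'a set \<Rightarrow> 'a set \<Rightarrow> ('a \<Rightarrow> 'a) set" where
  "trans_into X Y = {\<alpha> \<in> full_trans X. \<alpha> ` X \<subseteq> Y}"

definition perms_of :: "'a set \<Rightarrow> ('a \<Rightarrow> 'a) set" where
  "perms_of Y = {\<sigma> \<in> full_trans Y. bij_betw \<sigma> Y Y}"

(* Maps act on the right: the product of \<alpha> and \<beta> applies \<alpha> first. *)
definition tmult :: "'a set \<Rightarrow> ('a \<Rightarrow> 'a) \<Rightarrow> ('a \<Rightarrow> 'a) \<Rightarrow> ('a \<Rightarrow> 'a)" where
  "tmult X \<alpha> \<beta> = compose X \<beta> \<alpha>"

inductive_set gen_subsemigroup :: "('s \<Rightarrow> 's \<Rightarrow> 's) \<Rightarrow> 's set \<Rightarrow> 's set"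
  for mult :: "'s \<Rightarrow> 's \<Rightarrow> 's" and G :: "'s set" where
  gen: "x \<in> G \<Longrightarrow> x \<in> gen_subsemigroup mult G"
| mult: "x \<in> gen_subsemigroup mult G \<Longrightarrow> y \<in> gen_subsemigroup mult G \<Longrightarrow>
    mult x y \<in> gen_subsemigroup mult G"

definition rel_generating_set ::
    "('s \<Rightarrow> 's \<Rightarrow> 's) \<Rightarrow> 's set \<Rightarrow> 's set \<Rightarrow> 's set \<Rightarrow> bool" where
  "rel_generating_set mult S A B \<longleftrightarrow> B \<subseteq> S \<and> gen_subsemigroup mult (A \<union> B) = S"

definition minimal_rel_generating_set ::
    "('s \<Rightarrow> 's \<Rightarrow> 's) \<Rightarrow> 's set \<Rightarrow> 's set \<Rightarrow> 's set \<Rightarrow> bool" where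
  "minimal_rel_generating_set mult S A B \<longleftrightarrow>
     rel_generating_set mult S A B \<and> (\<forall>C. C \<subset> B \<longrightarrow> \<not> rel_generating_set mult S A C)"

definition set_less :: "'a::linorder set \<Rightarrow> 'a set \<Rightarrow> bool" where
  "set_less A B \<longleftrightarrow> (\<forall>x\<in>A. \<forall>y\<in>B. x < y)"

definition orientation_preserving :: "'a::linorder set \<Rightarrow> ('a \<Rightarrow> 'a) \<Rightarrow> bool" where
  "orientation_preserving X \<alpha> \<longleftrightarrow>
     (\<exists>X1 X2. X1 \<subseteq> X \<and> X2 \<subseteq> X \<and> X = X1 \<union> X2 \<and> X1 \<noteq> {} \<and> set_less X1 X2 \<and>
        (\<forall>x y. ((x, y) \<in> X1 \<times> X1 \<union> X2 \<times> X2 \<and> x \<le> y) \<or> (x, y) \<in> X2 \<times> X1 \<longrightarrow> \<alpha> x \<le> \<alpha> y))"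

definition op_trans_into :: "'a::linorder set \<Rightarrow> 'a set \<Rightarrow> ('a \<Rightarrow> 'a) set" where
  "op_trans_into X Y = {\<alpha> \<in> trans_into X Y. orientation_preserving X \<alpha>}"

definition ker_part :: "'a set \<Rightarrow> ('a \<Rightarrow> 'a) \<Rightarrow> 'a set set" where
  "ker_part X \<alpha> = (\<lambda>x. {y \<in> X. \<alpha> y = x}) ` (\<alpha> ` X)"

definition convex_in :: "'a::linorder set \<Rightarrow> 'a set \<Rightarrow> bool" where
  "convex_in X A \<longleftrightarrow> A \<subseteq> X \<and> (\<forall>x\<in>A. \<forall>z\<in>A. \<forall>y\<in>X. x < y \<and> y < z \<longrightarrow> y \<in> A)"

(* P is a partition of {1..n} whose m distinct blocks are A 1, ..., A m. *)
definition partition_listing :: "nat \<Rightarrow> nat \<Rightarrow> (nat \<Rightarrow> nat set) \<Rightarrow> nat set set \<Rightarrow> bool" where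
  "partition_listing n m A P \<longleftrightarrow> partition_on {1..n} P \<and> bij_betw A {1..m} P"

definition Q_partitions :: "nat \<Rightarrow> nat \<Rightarrow> nat set set set" where
  "Q_partitions n m = {P. \<exists>A. partition_listing n m A P \<and>
     (\<forall>i\<in>{1..m}. convex_in {1..n} (A i)) \<and>
     (\<forall>i\<in>{1..m}. \<forall>j\<in>{1..m}. i < j \<longrightarrow> set_less (A i) (A j))}"

definition P_partitions :: "nat \<Rightarrow> nat \<Rightarrow> nat set set set" where
  "P_partitions n m = {P. \<exists>A. partition_listing n m A P \<and>
     (\<forall>i\<in>{2..m}. convex_in {1..n} (A i)) \<and>
     (\<forall>i\<in>{2..m}. \<forall>j\<in>{2..m}. i < j \<longrightarrow> set_less (A i) (A j)) \<and>
     (\<exists>C D. convex_in {1..n} C \<and> convex_in {1..n} D \<and> A 1 = C \<union> D) \<and>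
     1 \<in> A 1 \<and> n \<in> A 1}"

definition R_partitions :: "nat \<Rightarrow> nat \<Rightarrow> nat set set set" where
  "R_partitions n m =
     {P. partition_on {1..n} P \<and> card P = m \<and> P \<notin> Q_partitions n m \<union> P_partitions n m}"

(* The cyclic permutation a 1 \<mapsto> a 2 \<mapsto> ... \<mapsto> a m \<mapsto> a 1, for a injective on {1..m}. *)
definition cyclic_perm :: "nat \<Rightarrow> (nat \<Rightarrow> 'a) \<Rightarrow> 'a \<Rightarrow> 'a" where
  "cyclic_perm m a = (\<lambda>y \<in> a ` {1..m}.
     let i = the_inv_into {1..m} a y in if i < m then a (i + 1) else a 1)"

end

theory Submission
  imports Defs "HOL-Library.Infinite_Set" "HOL-Combinatorics.Transposition"
begin

text \<open>
  The theorem rests on a criterion for generation: a set \<open>B\<close> generates \<open>\<T>(X,Y)\<close> modulo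
  \<open>\<O>\<P>(X,Y)\<close> exactly when every partition in \<open>\<R>\<^sub>m\<close> is a kernel of an element of \<open>B\<close> and the
  restrictions of \<open>B\<close> to \<open>Y\<close>, together with the cycle \<open>\<eta>|\<^sub>Y\<close>, generate all permutations of \<open>Y\<close>
  (\<open>rel_generating_set_iff\<close>).

  Both conditions are forced. If a product has image \<open>Y\<close>, then so has its first factor, and all
  later factors permute \<open>Y\<close>; hence the product has the kernel of its first factor
  (\<open>kernel_of_full_rank_product\<close>). An orientation-preserving map of rank \<open>m\<close> has its kernel in
  \<open>\<Q>\<^sub>m \<union> \<P>\<^sub>m\<close> (\<open>ker_part_orientation_preserving\<close>), so a kernel in \<open>\<R>\<^sub>m\<close> can only come from \<open>B\<close>.
  Restriction to \<open>Y\<close> is a homomorphism onto \<open>\<T>(Y)\<close>; a product of self-maps of the finite set \<open>Y\<close>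
  is a permutation only if all factors are, and an orientation-preserving map that permutes \<open>Y\<close>
  restricts to a power of \<open>\<eta>|\<^sub>Y\<close> (\<open>orientation_preserving_perm_is_cyc_power\<close>).

  Conversely, every orientation-preserving self-map of \<open>Y\<close> extends to \<open>\<O>\<P>(X,Y)\<close>
  (\<open>orientation_preserving_extension\<close>). So the generated semigroup contains extensions of all
  permutations of \<open>Y\<close> and of the map that collapses \<open>a\<^sub>1\<close> to \<open>a\<^sub>2\<close>. A map of rank \<open>m\<close> is a
  generator with the same kernel followed by a permutation of \<open>Y\<close>, because the partitions in
  \<open>\<Q>\<^sub>m \<union> \<P>\<^sub>m\<close> are kernels of orientation-preserving maps. A map of rank below \<open>m\<close> is a map of rank
  one higher, followed by the collapse and a permutation; induction on \<open>m\<close> minus the rank concludes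
  (\<open>relative_generation_sufficient\<close>).

  The criterion reduces minimality to counting (\<open>minimal_covering_family_iff\<close>): the
  set \<open>B \<setminus> B~\<close> consists of one element of \<open>B\<close> for each kernel in \<open>\<R>\<^sub>m\<close>, and \<open>B~\<close> is the rest.
  An element sharing its kernel with a member of \<open>B~\<close> can be removed without losing a kernel in
  \<open>\<R>\<^sub>m\<close>, so in a minimal \<open>B\<close> its removal must destroy the generation of the permutations of \<open>Y\<close>.
\<close>

section \<open>Generated subsemigroups\<close>

lemma gen_subsemigroup_mono:
  assumes "G \<subseteq> gen_subsemigroup mult H"
  shows "gen_subsemigroup mult G \<subseteq> gen_subsemigroup mult H"
proof
  fix x assume "x \<in> gen_subsemigroup mult G"
  then show "x \<in> gen_subsemigroup mult H"
    by induction (use assms in \<open>auto intro: gen_subsemigroup.mult\<close>)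
qed

lemma gen_subsemigroup_subset:
  assumes "G \<subseteq> S" and "\<And>x y. x \<in> S \<Longrightarrow> y \<in> S \<Longrightarrow> mult x y \<in> S"
  shows "gen_subsemigroup mult G \<subseteq> S"
proof
  fix x assume "x \<in> gen_subsemigroup mult G"
  then show "x \<in> S" by induction (use assms in auto)
qed

lemma gen_subsemigroup_hom_image:
  assumes G: "G \<subseteq> S" and closed: "\<And>x y. x \<in> S \<Longrightarrow> y \<in> S \<Longrightarrow> mult x y \<in> S"
    and hom: "\<And>x y. x \<in> S \<Longrightarrow> y \<in> S \<Longrightarrow> h (mult x y) = mult' (h x) (h y)"
  shows "gen_subsemigroup mult' (h ` G) = h ` gen_subsemigroup mult G" (is "?L = h ` ?R")
proof
  have R: "?R \<subseteq> S" using gen_subsemigroup_subset[OF G closed] .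
  show "?L \<subseteq> h ` ?R"
  proof
    fix y assume "y \<in> ?L"
    then show "y \<in> h ` ?R"
    proof induction
      case (gen y) then show ?case by (auto intro: gen_subsemigroup.gen)
    next
      case (mult u v)
      then obtain x y where "x \<in> ?R" "y \<in> ?R" "u = h x" "v = h y" by auto
      then have "mult' u v = h (mult x y)" "mult x y \<in> ?R"
        using hom[of x y] subsetD[OF R] by (auto intro: gen_subsemigroup.mult)
      then show ?case by auto
    qed
  qed
  have "h x \<in> ?L" if "x \<in> ?R" for x
    using that
  proof induction
    case (gen x) then show ?case by (auto intro: gen_subsemigroup.gen)
  next
    case (mult x y)
    then have "h (mult x y) = mult' (h x) (h y)" using hom R by blast
    then show ?case using mult.IH by (simp add: gen_subsemigroup.mult)
  qed
  then show "h ` ?R \<subseteq> ?L" by auto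
qed

lemma bij_betw_factors_of_product:
  assumes "finite Y" "f \<in> Y \<rightarrow> Y" "g \<in> Y \<rightarrow> Y" "bij_betw (compose Y g f) Y Y"
  shows "bij_betw f Y Y" "bij_betw g Y Y"
proof -
  have inj: "inj_on (compose Y g f) Y" and sur: "compose Y g f ` Y = Y"
    using assms(4) by (auto simp: bij_betw_def)
  have "inj_on f Y"
    using inj unfolding inj_on_def compose_def by (metis (no_types, lifting) restrict_apply')
  then have "f ` Y = Y" using endo_inj_surj[OF assms(1)] assms(2) by auto
  then show "bij_betw f Y Y" using \<open>inj_on f Y\<close> by (simp add: bij_betw_def)
  have "compose Y g f ` Y = g ` (f ` Y)" by (auto simp: compose_def)
  then have "g ` Y = Y" using sur \<open>f ` Y = Y\<close> by simp
  then show "bij_betw g Y Y" using eq_card_imp_inj_on[OF assms(1), of g] by (simp add: bij_betw_def)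
qed

text \<open>
  The non-bijective elements of a generating set are useless for building permutations of a finite
  set. This is what eliminates all orientation-preserving generators except those that permute \<open>Y\<close>.
\<close>
lemma permutation_products_use_permutation_generators:
  assumes "finite Y" and G: "G \<subseteq> full_trans Y"
    and "\<sigma> \<in> gen_subsemigroup (tmult Y) G" "\<sigma> \<in> perms_of Y"
  shows "\<sigma> \<in> gen_subsemigroup (tmult Y) (G \<inter> perms_of Y)"
  using assms(3,4)
proof induction
  case (gen \<sigma>)
  then show ?case by (auto intro: gen_subsemigroup.gen)
next
  case (mult f g)
  have "gen_subsemigroup (tmult Y) G \<subseteq> full_trans Y"
    by (rule gen_subsemigroup_subset[OF G]) (auto simp: full_trans_def tmult_def compose_def)
  then have fg: "f \<in> full_trans Y" "g \<in> full_trans Y" using mult.hyps by auto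
  have "bij_betw (compose Y g f) Y Y" using mult.prems by (simp add: perms_of_def tmult_def)
  then have "bij_betw f Y Y" "bij_betw g Y Y"
    using bij_betw_factors_of_product[OF \<open>finite Y\<close>, of f g] fg
    by (auto simp: full_trans_def PiE_def)
  then show ?case using mult.IH fg by (simp add: perms_of_def gen_subsemigroup.mult)
qed

section \<open>Kernels\<close>

text \<open>Kernels are compared below as equivalence relations rather than as sets of blocks.\<close>
lemma ker_part_cong_iff:
  "ker_part X \<alpha> = ker_part X \<beta> \<longleftrightarrow> (\<forall>x\<in>X. \<forall>y\<in>X. \<alpha> x = \<alpha> y \<longleftrightarrow> \<beta> x = \<beta> y)"
proof
  assume eq: "ker_part X \<alpha> = ker_part X \<beta>"
  have *: "\<forall>x\<in>X. \<forall>y\<in>X. f x = f y \<longrightarrow> g x = g y" if "ker_part X f = ker_part X g"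
    for f g :: "'a \<Rightarrow> 'a"
  proof (intro ballI impI)
    fix x y assume xy: "x \<in> X" "y \<in> X" "f x = f y"
    have "{z \<in> X. f z = f x} \<in> ker_part X g" using that xy by (auto simp: ker_part_def)
    then obtain v where "{z \<in> X. f z = f x} = {z \<in> X. g z = v}" by (auto simp: ker_part_def)
    moreover have "x \<in> {z \<in> X. f z = f x}" "y \<in> {z \<in> X. f z = f x}" using xy by simp_all
    ultimately have "x \<in> {z \<in> X. g z = v}" "y \<in> {z \<in> X. g z = v}" by (metis (lifting))+
    then show "g x = g y" by simp
  qed
  show "\<forall>x\<in>X. \<forall>y\<in>X. \<alpha> x = \<alpha> y \<longleftrightarrow> \<beta> x = \<beta> y"
    using *[OF eq] *[OF eq[symmetric]] by blast
next
  assume "\<forall>x\<in>X. \<forall>y\<in>X. \<alpha> x = \<alpha> y \<longleftrightarrow> \<beta> x = \<beta> y"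
  then have "{y \<in> X. \<alpha> y = \<alpha> x} = {y \<in> X. \<beta> y = \<beta> x}" if "x \<in> X" for x using that by auto
  then show "ker_part X \<alpha> = ker_part X \<beta>"
    unfolding ker_part_def image_image by (intro image_cong) auto
qed

lemma partition_on_ker_part: "partition_on X (ker_part X \<alpha>)"
  by (rule partition_onI) (auto simp: ker_part_def disjnt_def)

lemma card_ker_part: "card (ker_part X \<alpha>) = card (\<alpha> ` X)"
  unfolding ker_part_def by (rule card_image) (auto simp: inj_on_def)

text \<open>
  The listing \<open>A\<close> of the blocks is kept in the conclusion because orientation preservation of the
  resulting map depends on which value each block receives.
\<close>
lemma map_with_listed_kernel:
  assumes part: "partition_on X P" and A: "bij_betw A I P" and inj: "inj_on a I"
  obtains \<beta> where "\<beta> \<in> X \<rightarrow>\<^sub>E a ` I" "ker_part X \<beta> = P" "\<And>i x. i \<in> I \<Longrightarrow> x \<in> A i \<Longrightarrow> \<beta> x = a i"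
proof -
  have "\<exists>i\<in>I. x \<in> A i" if "x \<in> X" for x
    using that partition_onD1[OF part] bij_betw_imp_surj_on[OF A] by auto
  then obtain idx where idx: "idx x \<in> I" "x \<in> A (idx x)" if "x \<in> X" for x by metis
  have AX: "A i \<subseteq> X" "A i \<noteq> {}" if "i \<in> I" for i
    using that part bij_betw_imp_surj_on[OF A] by (auto simp: partition_on_def)
  have uniq: "i = j" if "i \<in> I" "j \<in> I" "x \<in> A i" "x \<in> A j" for i j x
  proof -
    have "A i \<in> P" "A j \<in> P" using that bij_betw_imp_surj_on[OF A] by auto
    then have "A i = A j" using partition_onD2[OF part] that by (auto simp: disjoint_def)
    then show ?thesis using bij_betw_imp_inj_on[OF A] that by (auto dest: inj_onD)
  qed
  define \<beta> where "\<beta> = (\<lambda>x\<in>X. a (idx x))"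
  have b: "\<beta> x = a i" if "i \<in> I" "x \<in> A i" for i x
    using uniq[OF that(1) idx(1) that(2) idx(2)] AX[OF that(1)] that by (auto simp: \<beta>_def)
  have blk: "{y \<in> X. \<beta> y = a i} = A i" if "i \<in> I" for i
  proof
    show "{y \<in> X. \<beta> y = a i} \<subseteq> A i"
      using idx inj_onD[OF inj _ _ that] by (fastforce simp: \<beta>_def)
    show "A i \<subseteq> {y \<in> X. \<beta> y = a i}" using b[OF that] AX(1)[OF that] by auto
  qed
  have img: "\<beta> ` X = a ` I"
    using b AX idx unfolding \<beta>_def by (fastforce simp: image_iff)
  have "ker_part X \<beta> = (\<lambda>i. {y \<in> X. \<beta> y = a i}) ` I" unfolding ker_part_def img image_image ..
  also have "\<dots> = A ` I" using blk by (intro image_cong) auto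
  also have "\<dots> = P" using A by (simp add: bij_betw_def)
  finally show thesis using b img by (intro that[of \<beta>]) (auto simp: \<beta>_def)
qed

section \<open>Kernels of orientation-preserving maps\<close>

text \<open>
  Of two disjoint convex sets, the one with the smaller minimum lies entirely below the other, so
  listing the blocks by their minima orders them.
\<close>
lemma convex_blocks_sorted:
  fixes P :: "nat set set"
  assumes "disjoint P" "{} \<notin> P" "finite X" and conv: "\<And>U. U \<in> P \<Longrightarrow> convex_in X U"
  obtains A where "bij_betw A {1..card P} P"
    "\<And>i j. i \<in> {1..card P} \<Longrightarrow> j \<in> {1..card P} \<Longrightarrow> i < j \<Longrightarrow> set_less (A i) (A j)"
proof -
  have sub: "U \<subseteq> X" if "U \<in> P" for U using conv[OF that] by (simp add: convex_in_def)
  have fin: "finite U" "U \<noteq> {}" if "U \<in> P" for U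
    using that sub assms(2) finite_subset[OF sub assms(3)] by auto
  have finP: "finite P" using sub assms(3) by (meson PowI finite_Pow_iff finite_subset subsetI)
  have less: "set_less U V" if "U \<in> P" "V \<in> P" "Min U < Min V" for U V
    unfolding set_less_def
  proof (intro ballI)
    fix u v assume uv: "u \<in> U" "v \<in> V"
    have "U \<noteq> V" using that by auto
    then have disj: "U \<inter> V = {}" using that assms(1) by (auto simp: disjoint_def)
    have mu: "Min U \<in> U" using fin[OF that(1)] by simp
    have "Min V \<le> v" using fin[OF that(2)] uv by simp
    show "u < v"
    proof (rule ccontr)
      assume "\<not> u < v"
      then have "Min U < v" "v < u" using that \<open>Min V \<le> v\<close> disj uv by (auto simp: not_less order_le_less)
      then have "v \<in> U" using conv[OF that(1)] mu uv sub[OF that(2)] unfolding convex_in_def by blast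
      then show False using disj uv by auto
    qed
  qed
  have inj: "inj_on Min P"
  proof (rule inj_onI)
    fix U V assume "U \<in> P" "V \<in> P" "Min U = Min V"
    then have "Min U \<in> U \<inter> V" using fin Min_in by (metis IntI)
    then show "U = V" using assms(1) \<open>U \<in> P\<close> \<open>V \<in> P\<close> by (auto simp: disjoint_def)
  qed
  obtain h where h: "bij_betw h {..<card (Min ` P)} (Min ` P)" "strict_mono_on {..<card (Min ` P)} h"
    using ex_bij_betw_strict_mono_card[of "Min ` P"] finP by auto
  have c: "card (Min ` P) = card P" using inj by (rule card_image)
  \<comment> \<open>The enumeration \<open>h\<close> of the minima starts at 0, while blocks are listed from 1.\<close>
  define A where "A = inv_into P Min \<circ> (h \<circ> (\<lambda>i. i - 1))"
  have sh: "bij_betw (\<lambda>i. i - 1) {1..card P} {..<card P}"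
    by (rule bij_betw_byWitness[where f' = Suc]) auto
  have "bij_betw (inv_into P Min) (Min ` P) P"
    using inj by (simp add: bij_betw_inv_into bij_betw_imageI)
  then have A: "bij_betw A {1..card P} P"
    unfolding A_def by (intro bij_betw_trans[OF bij_betw_trans[OF sh]]) (use h(1) c in auto)
  have MinA: "Min (A i) = h (i - 1)" if "i \<in> {1..card P}" for i
  proof -
    have "h (i - 1) \<in> Min ` P" using h(1) c that by (auto simp: bij_betw_def)
    then show ?thesis by (simp add: A_def f_inv_into_f)
  qed
  show thesis
  proof (rule that[OF A])
    fix i j assume ij: "i \<in> {1..card P}" "j \<in> {1..card P}" "i < j"
    then have "h (i - 1) < h (j - 1)" using h(2) c by (intro strict_mono_onD[OF h(2)]) auto
    then show "set_less (A i) (A j)"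
      using ij bij_betw_apply[OF A] by (intro less) (auto simp: MinA)
  qed
qed

lemma convex_partition_in_Q:
  assumes "partition_on {1..n} P" "card P = m" and "\<And>U. U \<in> P \<Longrightarrow> convex_in {1..n} U"
  shows "P \<in> Q_partitions n m"
proof -
  obtain A where "bij_betw A {1..card P} P"
    "\<And>i j. i \<in> {1..card P} \<Longrightarrow> j \<in> {1..card P} \<Longrightarrow> i < j \<Longrightarrow> set_less (A i) (A j)"
    using convex_blocks_sorted[of P "{1..n}"] assms by (auto simp: partition_on_def)
  then show ?thesis
    unfolding Q_partitions_def partition_listing_def using assms
    by (auto intro!: exI[of _ A] dest: bij_betw_apply)
qed

lemma wrapped_partition_in_P:
  assumes part: "partition_on {1..n} P" "card P = m" and B0: "B0 \<in> P" "1 \<in> B0" "n \<in> B0"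
    and CD: "convex_in {1..n} C" "convex_in {1..n} D" "B0 = C \<union> D"
    and conv: "\<And>U. U \<in> P \<Longrightarrow> U \<noteq> B0 \<Longrightarrow> convex_in {1..n} U"
  shows "P \<in> P_partitions n m"
proof -
  define P' where "P' = P - {B0}"
  have finP: "finite P" using finite_elements[of "{1..n}"] part by auto
  have cP': "card P' = m - 1" "1 \<le> m"
    using finP B0 part(2) by (auto simp: P'_def card_gt_0_iff Suc_le_eq)
  obtain A where A: "bij_betw A {1..m - 1} P'"
    and less: "\<And>i j. i \<in> {1..m - 1} \<Longrightarrow> j \<in> {1..m - 1} \<Longrightarrow> i < j \<Longrightarrow> set_less (A i) (A j)"
    using convex_blocks_sorted[of P' "{1..n}"] conv part(1) cP'
    by (auto simp: partition_on_def P'_def disjoint_def)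
  define A' where "A' i = (if i = 1 then B0 else A (i - 1))" for i
  have "bij_betw (\<lambda>i. i - 1) {2..m} {1..m - 1}"
    by (rule bij_betw_byWitness[where f' = Suc]) auto
  then have "bij_betw (A \<circ> (\<lambda>i. i - 1)) {2..m} P'" using A by (rule bij_betw_trans)
  moreover have "bij_betw (A \<circ> (\<lambda>i. i - 1)) {2..m} P' = bij_betw A' {2..m} P'"
    by (rule bij_betw_cong) (auto simp: A'_def)
  ultimately have A2: "bij_betw A' {2..m} P'" by simp
  moreover have "bij_betw A' {1} {B0}" by (simp add: A'_def bij_betw_def)
  ultimately have "bij_betw A' ({1} \<union> {2..m}) ({B0} \<union> P')"
    by (intro bij_betw_combine) (auto simp: P'_def)
  moreover have "{1} \<union> {2..m} = {1..m}" using cP' by auto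
  moreover have "{B0} \<union> P' = P" using B0 by (auto simp: P'_def)
  ultimately have bij: "bij_betw A' {1..m} P" by simp
  have "convex_in {1..n} (A' i)" if "i \<in> {2..m}" for i
    using bij_betw_apply[OF A2 that] conv by (auto simp: P'_def)
  moreover have "set_less (A' i) (A' j)" if "i \<in> {2..m}" "j \<in> {2..m}" "i < j" for i j
    using that less[of "i - 1" "j - 1"] by (auto simp: A'_def)
  moreover have "A' 1 = B0" by (simp add: A'_def)
  ultimately show ?thesis
    unfolding P_partitions_def partition_listing_def using bij part(1) CD B0
    by (auto intro!: exI[of _ A'])
qed

lemma orientation_preservingE:
  assumes "orientation_preserving X \<alpha>"
  obtains X1 X2 where "X = X1 \<union> X2" "X1 \<noteq> {}" "\<And>x y. x \<in> X1 \<Longrightarrow> y \<in> X2 \<Longrightarrow> x < y"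
    "\<And>x y. x \<in> X1 \<Longrightarrow> y \<in> X1 \<Longrightarrow> x \<le> y \<Longrightarrow> \<alpha> x \<le> \<alpha> y"
    "\<And>x y. x \<in> X2 \<Longrightarrow> y \<in> X2 \<Longrightarrow> x \<le> y \<Longrightarrow> \<alpha> x \<le> \<alpha> y"
    "\<And>x y. x \<in> X2 \<Longrightarrow> y \<in> X1 \<Longrightarrow> \<alpha> x \<le> \<alpha> y"
proof -
  from assms obtain X1 X2 where X: "X = X1 \<union> X2" "X1 \<noteq> {}" "set_less X1 X2"
    and mono: "\<forall>x y. ((x, y) \<in> X1 \<times> X1 \<union> X2 \<times> X2 \<and> x \<le> y) \<or> (x, y) \<in> X2 \<times> X1
      \<longrightarrow> \<alpha> x \<le> \<alpha> y"
    unfolding orientation_preserving_def by (elim exE conjE)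
  show thesis
    by (rule that[OF X(1,2)])
      (use X(3) mono[rule_format] in \<open>simp_all add: set_less_def\<close>)
qed

lemma orientation_preservingI:
  assumes "X = X1 \<union> X2" "X1 \<noteq> {}" "\<And>x y. x \<in> X1 \<Longrightarrow> y \<in> X2 \<Longrightarrow> x < y"
    "\<And>x y. x \<in> X1 \<Longrightarrow> y \<in> X1 \<Longrightarrow> x \<le> y \<Longrightarrow> \<alpha> x \<le> \<alpha> y"
    "\<And>x y. x \<in> X2 \<Longrightarrow> y \<in> X2 \<Longrightarrow> x \<le> y \<Longrightarrow> \<alpha> x \<le> \<alpha> y"
    "\<And>x y. x \<in> X2 \<Longrightarrow> y \<in> X1 \<Longrightarrow> \<alpha> x \<le> \<alpha> y"
  shows "orientation_preserving X \<alpha>"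
  unfolding orientation_preserving_def set_less_def using assms
  by (intro exI[of _ X1] exI[of _ X2]) auto

lemma monotone_orientation_preserving:
  assumes "X \<noteq> {}" "\<And>x y. x \<in> X \<Longrightarrow> y \<in> X \<Longrightarrow> x \<le> y \<Longrightarrow> \<alpha> x \<le> \<alpha> y"
  shows "orientation_preserving X \<alpha>"
  by (rule orientation_preservingI[of _ X "{}"]) (use assms in auto)

text \<open>
  Within each of the two monotone pieces the level sets are convex. A level set meeting both pieces
  forces equality throughout \<open>\<alpha> n \<le> \<alpha> 1 \<le> \<dots> = \<dots> \<le> \<alpha> n\<close>, so it is the block of both 1 and \<open>n\<close>.
  Thus all blocks are convex, or the only exception is one block that wraps around.
\<close>
lemma ker_part_orientation_preserving:
  assumes "orientation_preserving {1..n} \<alpha>" "card (\<alpha> ` {1..n}) = m" "1 \<le> n"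
  shows "ker_part {1..n} \<alpha> \<in> Q_partitions n m \<union> P_partitions n m"
proof -
  obtain X1 X2 where X: "{1..n} = X1 \<union> X2" "X1 \<noteq> {}" "\<And>x y. x \<in> X1 \<Longrightarrow> y \<in> X2 \<Longrightarrow> x < y"
    and m1: "\<And>x y. x \<in> X1 \<Longrightarrow> y \<in> X1 \<Longrightarrow> x \<le> y \<Longrightarrow> \<alpha> x \<le> \<alpha> y"
    and m2: "\<And>x y. x \<in> X2 \<Longrightarrow> y \<in> X2 \<Longrightarrow> x \<le> y \<Longrightarrow> \<alpha> x \<le> \<alpha> y"
    and m21: "\<And>x y. x \<in> X2 \<Longrightarrow> y \<in> X1 \<Longrightarrow> \<alpha> x \<le> \<alpha> y"
    by (rule orientation_preservingE[OF assms(1)]) (rule that)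
  have X12: "x \<in> X1 \<or> x \<in> X2" if "x \<in> {1..n}" for x using that X(1) by blast
  have conv12: "convex_in {1..n} ({y \<in> {1..n}. \<alpha> y = v} \<inter> Z)" if Z: "Z = X1 \<or> Z = X2" for v Z
    unfolding convex_in_def
  proof (intro conjI ballI impI)
    show "{y \<in> {1..n}. \<alpha> y = v} \<inter> Z \<subseteq> {1..n}" by auto
    fix x z y
    assume x: "x \<in> {y \<in> {1..n}. \<alpha> y = v} \<inter> Z" and z: "z \<in> {y \<in> {1..n}. \<alpha> y = v} \<inter> Z"
      and y: "y \<in> {1..n}" "x < y \<and> y < z"
    have "y \<in> Z"
    proof (rule ccontr)
      assume "y \<notin> Z"
      then consider "Z = X1" "y \<in> X2" | "Z = X2" "y \<in> X1" using Z X12[OF y(1)] by blast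
      then show False using X(3)[of z y] X(3)[of y x] x y z by cases auto
    qed
    moreover have "\<alpha> x \<le> \<alpha> y" "\<alpha> y \<le> \<alpha> z" using x y z Z \<open>y \<in> Z\<close> m1[of x y] m2[of x y] m1[of y z] m2[of y z] by auto
    ultimately show "y \<in> {y \<in> {1..n}. \<alpha> y = v} \<inter> Z" using x y z by auto
  qed
  have conv: "convex_in {1..n} {y \<in> {1..n}. \<alpha> y = v}" if v: "\<not> (\<alpha> 1 = v \<and> \<alpha> n = v)" for v
    unfolding convex_in_def
  proof (intro conjI ballI impI)
    show "{y \<in> {1..n}. \<alpha> y = v} \<subseteq> {1..n}" by auto
    fix x z y
    assume x: "x \<in> {y \<in> {1..n}. \<alpha> y = v}" and z: "z \<in> {y \<in> {1..n}. \<alpha> y = v}"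
      and y: "y \<in> {1..n}" "x < y \<and> y < z"
    have "\<not> (x \<in> X1 \<and> z \<in> X2)"
    proof
      assume xz: "x \<in> X1 \<and> z \<in> X2"
      have "1 \<in> X1" using X12[of 1] X(3)[of x 1] xz x assms(3) by auto
      moreover have "n \<in> X2" using X12[of n] X(3)[of n z] xz z assms(3) by auto
      ultimately have "\<alpha> n \<le> \<alpha> 1" "\<alpha> 1 \<le> \<alpha> x" "\<alpha> z \<le> \<alpha> n" using m21[of n 1] m1[of 1 x] m2[of z n] xz x z by auto
      then show False using v x z by auto
    qed
    moreover have "\<not> (x \<in> X2 \<and> z \<in> X1)" using X(3)[of z x] y by auto
    ultimately obtain Z where "Z = X1 \<or> Z = X2" "x \<in> Z" "z \<in> Z" using X12[of x] X12[of z] x z by blast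
    then show "y \<in> {y \<in> {1..n}. \<alpha> y = v}"
      using conv12[of Z v, unfolded convex_in_def, THEN conjunct2, rule_format, of x z y] x z y
      by simp
  qed
  note part = partition_on_ker_part[of "{1..n}" \<alpha>]
  have card: "card (ker_part {1..n} \<alpha>) = m" using assms(2) by (simp add: card_ker_part)
  show ?thesis
  proof (cases "\<alpha> 1 = \<alpha> n")
    case False
    then have "convex_in {1..n} U" if "U \<in> ker_part {1..n} \<alpha>" for U
      using that conv by (auto simp: ker_part_def)
    then show ?thesis using convex_partition_in_Q[OF part card] by simp
  next
    case True
    let ?B0 = "{y \<in> {1..n}. \<alpha> y = \<alpha> 1}"
    have "?B0 \<in> ker_part {1..n} \<alpha>" using assms(3) by (auto simp: ker_part_def)
    moreover have "?B0 = (?B0 \<inter> X1) \<union> (?B0 \<inter> X2)" using X12 by blast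
    moreover have "convex_in {1..n} U" if "U \<in> ker_part {1..n} \<alpha>" "U \<noteq> ?B0" for U
      using that conv by (auto simp: ker_part_def)
    ultimately have "ker_part {1..n} \<alpha> \<in> P_partitions n m"
      using assms(3) True
      by (intro wrapped_partition_in_P[OF part card, of ?B0 "?B0 \<inter> X1" "?B0 \<inter> X2"] conv12) auto
    then show ?thesis by simp
  qed
qed

text \<open>
  Sending the \<open>i\<close>-th block to \<open>a\<^sub>i\<close> works for both types of partition. The only descent of this map is
  at the final segment of a wrapped first block: it returns to the least value \<open>a\<^sub>1\<close> there.
\<close>
lemma orientation_preserving_with_kernel:
  assumes P: "P \<in> Q_partitions n m \<union> P_partitions n m" and m: "1 < m"
    and a: "strict_mono_on {1..m} (a :: nat \<Rightarrow> nat)"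
  obtains \<beta> where "\<beta> \<in> {1..n} \<rightarrow>\<^sub>E a ` {1..m}" "ker_part {1..n} \<beta> = P" "orientation_preserving {1..n} \<beta>"
proof -
  have a_le: "a i \<le> a j" if "i \<in> {1..m}" "j \<in> {1..m}" "i \<le> j" for i j
    using strict_mono_on_leD[OF a] that by blast
  have inj: "inj_on a {1..m}" using a by (rule strict_mono_on_imp_inj_on)
  obtain A where list: "partition_listing n m A P"
    and less: "\<And>i j. i \<in> {2..m} \<Longrightarrow> j \<in> {2..m} \<Longrightarrow> i < j \<Longrightarrow> set_less (A i) (A j)"
    and first: "(\<forall>j\<in>{2..m}. set_less (A 1) (A j)) \<or>
      (\<exists>C D. convex_in {1..n} C \<and> convex_in {1..n} D \<and> A 1 = C \<union> D \<and> 1 \<in> A 1 \<and> n \<in> A 1)"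
  proof -
    from P consider "P \<in> Q_partitions n m" | "P \<in> P_partitions n m" by auto
    then show thesis
    proof cases
      case 1
      then obtain A where "partition_listing n m A P"
        "\<forall>i\<in>{1..m}. \<forall>j\<in>{1..m}. i < j \<longrightarrow> set_less (A i) (A j)" unfolding Q_partitions_def by blast
      then show thesis using m by (intro that[of A]) auto
    next
      case 2
      then show thesis unfolding P_partitions_def using that by blast
    qed
  qed
  have part: "partition_on {1..n} P" and A: "bij_betw A {1..m} P"
    using list by (auto simp: partition_listing_def)
  obtain \<beta> where \<beta>: "\<beta> \<in> {1..n} \<rightarrow>\<^sub>E a ` {1..m}" "ker_part {1..n} \<beta> = P"
    and val: "\<And>i x. i \<in> {1..m} \<Longrightarrow> x \<in> A i \<Longrightarrow> \<beta> x = a i"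
    using map_with_listed_kernel[OF part A inj] by metis
  have cov: "\<exists>i\<in>{1..m}. x \<in> A i" if "x \<in> {1..n}" for x
    using that partition_onD1[OF part] bij_betw_imp_surj_on[OF A] by auto
  have AX: "A i \<subseteq> {1..n}" "A i \<noteq> {}" if "i \<in> {1..m}" for i
    using that part bij_betw_imp_surj_on[OF A] by (auto simp: partition_on_def)
  have min: "a 1 \<le> \<beta> x" if "x \<in> {1..n}" for x
    using cov[OF that] val a_le m by fastforce
  \<comment> \<open>\<open>X2\<close> is the largest final segment of the chain that lies in the first block; for a partition
    into convex blocks it is empty, as \<open>m > 1\<close>.\<close>
  define X1 where "X1 = {x \<in> {1..n}. \<exists>y\<in>{1..n}. x \<le> y \<and> y \<notin> A 1}"
  define X2 where "X2 = {x \<in> {1..n}. \<forall>y\<in>{1..n}. x \<le> y \<longrightarrow> y \<in> A 1}"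
  have X2: "\<beta> x = a 1" if "x \<in> X2" for x using that val[of 1 x] m by (auto simp: X2_def)
  have "A 2 \<noteq> A 1" using bij_betw_imp_inj_on[OF A] m by (auto dest: inj_onD)
  then have "A 1 \<inter> A 2 = {}"
    using partition_onD2[OF part] bij_betw_apply[OF A] m by (auto simp: disjoint_def)
  moreover obtain y where "y \<in> A 2" using AX(2)[of 2] m by auto
  ultimately have "y \<in> X1" using AX(1)[of 2] m by (auto simp: X1_def)
  then have ne: "X1 \<noteq> {}" by auto
  have mono: "\<beta> x \<le> \<beta> y" if xy: "x \<in> X1" "y \<in> X1" "x \<le> y" for x y
  proof -
    obtain i j where i: "i \<in> {1..m}" "x \<in> A i" and j: "j \<in> {1..m}" "y \<in> A j"
      using cov[of x] cov[of y] xy by (auto simp: X1_def)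
    have "i \<le> j"
    proof (rule ccontr)
      assume "\<not> i \<le> j"
      then have i2: "i \<in> {2..m}" "j < i" using i j by auto
      have xA: "x \<notin> A 1"
      proof
        assume "x \<in> A 1"
        then have "a 1 = a i" using val[OF i] val[of 1 x] m by simp
        then show False using inj_onD[OF inj, of 1 i] i i2 by auto
      qed
      show False
      proof (cases "j = 1")
        case False
        then have "set_less (A j) (A i)" using less i2 j by auto
        then have "y < x" using i j unfolding set_less_def by blast
        then show False using xy by simp
      next
        case True
        then have y1: "y \<in> A 1" using j by simp
        then have "\<not> (\<forall>j\<in>{2..m}. set_less (A 1) (A j))"
          using i2 i xy unfolding set_less_def by (metis leD)
        then obtain C D where CD: "convex_in {1..n} C" "convex_in {1..n} D" "A 1 = C \<union> D"
          "1 \<in> A 1" "n \<in> A 1" using first by blast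
        obtain z where z: "z \<in> {1..n}" "y \<le> z" "z \<notin> A 1" using xy by (auto simp: X1_def)
        have xX: "x \<in> {1..n}" using xy by (auto simp: X1_def)
        have ord: "1 < x" "x < y" "y < z" "z < n"
          using xX xA z y1 CD xy by (metis atLeastAtMost_iff order_le_less)+
        \<comment> \<open>The points 1, \<open>y\<close>, \<open>n\<close> of the first block are pairwise separated by points outside of it,
          too many for a union of two convex sets.\<close>
        have between: "t \<in> A 1" if "E = C \<or> E = D" "u \<in> E" "w \<in> E" "t \<in> {1..n}" "u < t" "t < w"
          for E t u w
          using that CD(1,2) unfolding CD(3) convex_in_def by blast
        have "1 \<in> C \<or> 1 \<in> D" "n \<in> C \<or> n \<in> D" "y \<in> C \<or> y \<in> D" using CD y1 by auto
        moreover have "\<not> (E = C \<or> E = D) \<or> \<not> (1 \<in> E \<and> y \<in> E)" for E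
          using between[of E 1 y x] xA xX ord by blast
        moreover have "\<not> (E = C \<or> E = D) \<or> \<not> (y \<in> E \<and> n \<in> E)" for E
          using between[of E y n z] z ord by blast
        moreover have "\<not> (E = C \<or> E = D) \<or> \<not> (1 \<in> E \<and> n \<in> E)" for E
          using between[of E 1 n x] xA xX ord by fastforce
        ultimately show False by blast
      qed
    qed
    then show ?thesis using val[OF i] val[OF j] a_le[OF i(1) j(1)] by simp
  qed
  have "orientation_preserving {1..n} \<beta>"
  proof (rule orientation_preservingI[of _ X1 X2])
    show "{1..n} = X1 \<union> X2" by (auto simp: X1_def X2_def)
    show "x < y" if "x \<in> X1" "y \<in> X2" for x y
    proof (rule ccontr)
      assume "\<not> x < y"
      then show False using that unfolding X1_def X2_def by fastforce
    qed
    show "\<beta> x \<le> \<beta> y" if "x \<in> X2" "y \<in> X1" for x y using that X2 min by (auto simp: X1_def)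
  qed (use ne mono X2 in auto)
  then show thesis using that \<beta> by blast
qed

section \<open>Transformations of a finite chain into a subset\<close>

locale chain_with_range =
  fixes n m :: nat and a :: "nat \<Rightarrow> nat" and X Y :: "nat set"
  assumes X_eq: "X = {1..n}" and m_gt_1: "1 < m" and a_mono: "strict_mono_on {1..m} a"
    and Y_eq: "Y = a ` {1..m}" and Y_subset: "Y \<subseteq> X"
begin

abbreviation cyc :: "nat \<Rightarrow> nat" where "cyc \<equiv> cyclic_perm m a"

abbreviation restr :: "(nat \<Rightarrow> nat) \<Rightarrow> nat \<Rightarrow> nat" where "restr \<equiv> \<lambda>\<alpha>. restrict \<alpha> Y"

lemma finite_X: "finite X" and finite_Y: "finite Y" by (simp_all add: X_eq Y_eq)

lemma inj_a: "inj_on a {1..m}" using a_mono by (rule strict_mono_on_imp_inj_on)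

lemma card_Y: "card Y = m" using card_image[OF inj_a] by (simp add: Y_eq)

lemma a_in_Y: "i \<in> {1..m} \<Longrightarrow> a i \<in> Y" by (simp add: Y_eq)

lemma a_less_iff: "i \<in> {1..m} \<Longrightarrow> j \<in> {1..m} \<Longrightarrow> a i < a j \<longleftrightarrow> i < j"
  using strict_mono_on_less[OF a_mono] by blast

lemma a_le_iff: "i \<in> {1..m} \<Longrightarrow> j \<in> {1..m} \<Longrightarrow> a i \<le> a j \<longleftrightarrow> i \<le> j"
  using strict_mono_on_less_eq[OF a_mono] by blast

lemma a_eq_iff: "i \<in> {1..m} \<Longrightarrow> j \<in> {1..m} \<Longrightarrow> a i = a j \<longleftrightarrow> i = j"
  using inj_a by (auto dest: inj_onD)

lemma in_YE:
  assumes "y \<in> Y" obtains i where "i \<in> {1..m}" "y = a i"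
  using assms by (auto simp: Y_eq)

lemma X_nonempty: "X \<noteq> {}" using a_in_Y[of 1] m_gt_1 Y_subset by auto

lemma trans_into_eq: "trans_into X Y = X \<rightarrow>\<^sub>E Y"
  using Y_subset by (auto simp: trans_into_def full_trans_def PiE_iff extensional_def)

lemma op_subset: "op_trans_into X Y \<subseteq> X \<rightarrow>\<^sub>E Y"
  by (auto simp: op_trans_into_def trans_into_eq)

lemma tmult_closed: "\<alpha> \<in> X \<rightarrow>\<^sub>E Y \<Longrightarrow> \<beta> \<in> X \<rightarrow>\<^sub>E Y \<Longrightarrow> tmult X \<alpha> \<beta> \<in> X \<rightarrow>\<^sub>E Y"
  using Y_subset by (auto simp: tmult_def compose_def PiE_iff)

lemma restr_closed: "\<alpha> \<in> X \<rightarrow>\<^sub>E Y \<Longrightarrow> restr \<alpha> \<in> Y \<rightarrow>\<^sub>E Y"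
  using Y_subset by (auto simp: PiE_iff)

lemma gen_subset:
  assumes "G \<subseteq> X \<rightarrow>\<^sub>E Y" shows "gen_subsemigroup (tmult X) G \<subseteq> X \<rightarrow>\<^sub>E Y"
  by (rule gen_subsemigroup_subset[OF assms tmult_closed])

text \<open>
  Because all images lie in \<open>Y\<close>, restriction to \<open>Y\<close> is a homomorphism \<open>\<T>(X,Y) \<rightarrow> \<T>(Y)\<close>; this lets
  generation be transported in both directions.
\<close>
lemma gen_restr:
  assumes "G \<subseteq> X \<rightarrow>\<^sub>E Y"
  shows "gen_subsemigroup (tmult Y) (restr ` G) = restr ` gen_subsemigroup (tmult X) G"
proof (rule gen_subsemigroup_hom_image[OF assms tmult_closed])
  fix \<alpha> \<beta> assume "\<alpha> \<in> X \<rightarrow>\<^sub>E Y" "\<beta> \<in> X \<rightarrow>\<^sub>E Y"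
  then show "restr (tmult X \<alpha> \<beta>) = tmult Y (restr \<alpha>) (restr \<beta>)"
    using Y_subset by (auto simp: tmult_def compose_def fun_eq_iff PiE_iff)
qed

section \<open>Orientation-preserving maps and permutations of the range\<close>

text \<open>
  The map is precomposed with an order-preserving retraction of the chain \<open>X\<close> onto \<open>Y\<close>.
\<close>
lemma orientation_preserving_extension:
  assumes \<phi>: "\<phi> \<in> Y \<rightarrow>\<^sub>E Y" "orientation_preserving Y \<phi>"
  shows "\<phi> \<in> restr ` op_trans_into X Y"
proof -
  \<comment> \<open>The retraction sends \<open>x\<close> to the next element of \<open>Y\<close> from above; inserting \<open>a m\<close> gives a value
    to the points above all of \<open>Y\<close>.\<close>
  define S where "S x = insert (a m) {y \<in> Y. x \<le> y}" for x
  define r where "r x = Min (S x)" for x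
  have S: "finite (S x)" "S x \<noteq> {}" "S x \<subseteq> Y" for x
    using finite_Y a_in_Y[of m] m_gt_1 by (auto simp: S_def)
  have rY: "r x \<in> Y" for x using Min_in[OF S(1,2)] S(3) unfolding r_def by blast
  have rmono: "r x \<le> r y" if "x \<le> y" for x y
    unfolding r_def by (rule Min_antimono) (use that S in \<open>auto simp: S_def\<close>)
  have rfix: "r y = y" if "y \<in> Y" for y
    unfolding r_def
  proof (rule Min_eqI[OF S(1)])
    obtain i where i: "i \<in> {1..m}" "y = a i" using \<open>y \<in> Y\<close> by (auto simp: Y_eq)
    then have "y \<le> a m" using a_le_iff[of i m] m_gt_1 by simp
    then show "y \<le> z" if "z \<in> S y" for z using that by (auto simp: S_def)
    show "y \<in> S y" using that by (simp add: S_def)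
  qed
  define \<alpha> where "\<alpha> = (\<lambda>x\<in>X. \<phi> (r x))"
  obtain Y1 Y2 where Y12: "Y = Y1 \<union> Y2" "Y1 \<noteq> {}" "\<And>x y. x \<in> Y1 \<Longrightarrow> y \<in> Y2 \<Longrightarrow> x < y"
    and m1: "\<And>x y. x \<in> Y1 \<Longrightarrow> y \<in> Y1 \<Longrightarrow> x \<le> y \<Longrightarrow> \<phi> x \<le> \<phi> y"
    and m2: "\<And>x y. x \<in> Y2 \<Longrightarrow> y \<in> Y2 \<Longrightarrow> x \<le> y \<Longrightarrow> \<phi> x \<le> \<phi> y"
    and m21: "\<And>x y. x \<in> Y2 \<Longrightarrow> y \<in> Y1 \<Longrightarrow> \<phi> x \<le> \<phi> y"
    by (rule orientation_preservingE[OF \<phi>(2)]) (rule that)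
  have "orientation_preserving X \<alpha>"
  proof (rule orientation_preservingI[of _ "{x \<in> X. r x \<in> Y1}" "{x \<in> X. r x \<in> Y2}"])
    show "X = {x \<in> X. r x \<in> Y1} \<union> {x \<in> X. r x \<in> Y2}" using rY Y12(1) by auto
    obtain y where "y \<in> Y1" using Y12(2) by auto
    then have "y \<in> {x \<in> X. r x \<in> Y1}" using rfix Y_subset Y12(1) by auto
    then show "{x \<in> X. r x \<in> Y1} \<noteq> {}" by auto
    show "x < y" if "x \<in> {x \<in> X. r x \<in> Y1}" "y \<in> {x \<in> X. r x \<in> Y2}" for x y
      using Y12(3)[of "r x" "r y"] rmono[of y x] that by (auto simp: not_le[symmetric])
  qed (use m1 m2 m21 rmono in \<open>auto simp: \<alpha>_def\<close>)
  moreover have "\<alpha> \<in> X \<rightarrow>\<^sub>E Y" using \<phi>(1) rY by (auto simp: \<alpha>_def)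
  ultimately have "\<alpha> \<in> op_trans_into X Y" by (simp add: op_trans_into_def trans_into_eq)
  moreover have "restr \<alpha> = \<phi>"
    using \<phi>(1) rfix Y_subset by (auto simp: \<alpha>_def fun_eq_iff PiE_iff extensional_def)
  ultimately show ?thesis by blast
qed

lemma cyc_a: "i \<in> {1..m} \<Longrightarrow> cyc (a i) = (if i < m then a (i + 1) else a 1)"
  using the_inv_into_f_f[OF inj_a, of i] by (simp add: cyclic_perm_def Let_def)

lemma cyc_in: "cyc \<in> Y \<rightarrow>\<^sub>E Y"
proof
  show "cyc y \<in> Y" if "y \<in> Y" for y
    using that m_gt_1 by (auto elim!: in_YE simp: cyc_a intro!: a_in_Y)
qed (auto simp: cyclic_perm_def Y_eq)

text \<open>
  The cycle increases except at \<open>a\<^sub>m\<close>, so its last point alone forms the second monotone piece.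
\<close>
lemma cyc_in_restr_op: "cyc \<in> restr ` op_trans_into X Y"
proof (rule orientation_preserving_extension[OF cyc_in])
  have m: "m \<in> {1..m}" "1 \<in> {1..m}" using m_gt_1 by auto
  have c: "cyc y \<in> Y" if "y \<in> Y" for y using cyc_in that by auto
  show "orientation_preserving Y cyc"
  proof (rule orientation_preservingI[of _ "Y - {a m}" "{a m}"])
    show "Y = Y - {a m} \<union> {a m}" using a_in_Y m by auto
    show "Y - {a m} \<noteq> {}" using a_in_Y[OF m(2)] a_eq_iff[OF m(2,1)] m_gt_1 by auto
    show "x < y" if "x \<in> Y - {a m}" "y \<in> {a m}" for x y
      using that m by (auto elim!: in_YE simp: a_less_iff order_le_less)
    show "cyc x \<le> cyc y" if "x \<in> Y - {a m}" "y \<in> Y - {a m}" "x \<le> y" for x y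
    proof -
      obtain i j where ij: "i \<in> {1..m}" "x = a i" "j \<in> {1..m}" "y = a j"
        using \<open>x \<in> Y - {a m}\<close> \<open>y \<in> Y - {a m}\<close> by (auto simp: Y_eq)
      then have "i < m" "j < m"
        using \<open>x \<in> Y - {a m}\<close> \<open>y \<in> Y - {a m}\<close> by (auto simp: order_le_less)
      then show ?thesis using ij \<open>x \<le> y\<close> by (simp add: cyc_a a_le_iff)
    qed
    show "cyc x \<le> cyc y" if "x \<in> {a m}" "y \<in> Y - {a m}" for x y
    proof -
      have "cyc y \<in> Y" using c that by simp
      then obtain j where "j \<in> {1..m}" "cyc y = a j" by (rule in_YE)
      then show ?thesis using that m by (simp add: cyc_a a_le_iff)
    qed
  qed auto
qed

text \<open>
  Products in a subsemigroup have at least one factor, so the induction starts at the exponent 1.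
  Residues are taken for the indices shifted to start at 0.
\<close>
lemma cyc_powers:
  assumes "1 \<le> k"
  shows "\<exists>\<tau>\<in>gen_subsemigroup (tmult Y) {cyc}. \<forall>i\<in>{1..m}. \<tau> (a i) = a ((i - 1 + k) mod m + 1)"
  using assms
proof (induction k rule: dec_induct)
  case base
  have "cyc (a i) = a ((i - 1 + 1) mod m + 1)" if "i \<in> {1..m}" for i
    using that by (cases "i = m") (auto simp: cyc_a)
  then show ?case by (auto intro!: bexI[of _ cyc] gen_subsemigroup.gen)
next
  case (step k)
  then obtain \<tau> where \<tau>: "\<tau> \<in> gen_subsemigroup (tmult Y) {cyc}"
    "\<And>i. i \<in> {1..m} \<Longrightarrow> \<tau> (a i) = a ((i - 1 + k) mod m + 1)" by blast
  have "tmult Y \<tau> cyc (a i) = a ((i - 1 + Suc k) mod m + 1)" if i: "i \<in> {1..m}" for i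
  proof -
    define q where "q = (i - 1 + k) mod m"
    have q: "q < m" using m_gt_1 by (simp add: q_def)
    have "tmult Y \<tau> cyc (a i) = cyc (a (q + 1))"
      using i \<tau>(2) a_in_Y by (simp add: tmult_def compose_def q_def)
    also have "\<dots> = a ((if Suc q = m then 0 else Suc q) + 1)" using q by (simp add: cyc_a)
    also have "(if Suc q = m then 0 else Suc q) = (i - 1 + Suc k) mod m"
      by (simp add: q_def mod_Suc)
    finally show ?thesis .
  qed
  moreover have "tmult Y \<tau> cyc \<in> gen_subsemigroup (tmult Y) {cyc}"
    using \<tau>(1) by (auto intro: gen_subsemigroup.intros)
  ultimately show ?case by blast
qed

text \<open>
  Let \<open>f\<close> be the permutation of indices induced by \<open>\<alpha>\<close>. The indices in the first monotone piece are
  \<open>1, \<dots>, p\<close>, and \<open>f\<close> increases strictly along \<open>p + 1, \<dots>, m, 1, \<dots>, p\<close>. As a bijection, \<open>f\<close> sends each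
  index to its position in this list, which makes it the rotation by \<open>m - p\<close>.
\<close>
lemma orientation_preserving_perm_is_cyc_power:
  assumes \<alpha>: "\<alpha> \<in> op_trans_into X Y" and perm: "restr \<alpha> \<in> perms_of Y"
  shows "restr \<alpha> \<in> gen_subsemigroup (tmult Y) {cyc}"
proof -
  have op: "orientation_preserving X \<alpha>" using \<alpha> by (simp add: op_trans_into_def)
  obtain X1 X2 where X12: "X = X1 \<union> X2" "X1 \<noteq> {}" "\<And>x y. x \<in> X1 \<Longrightarrow> y \<in> X2 \<Longrightarrow> x < y"
    and m1: "\<And>x y. x \<in> X1 \<Longrightarrow> y \<in> X1 \<Longrightarrow> x \<le> y \<Longrightarrow> \<alpha> x \<le> \<alpha> y"
    and m2: "\<And>x y. x \<in> X2 \<Longrightarrow> y \<in> X2 \<Longrightarrow> x \<le> y \<Longrightarrow> \<alpha> x \<le> \<alpha> y"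
    and m21: "\<And>x y. x \<in> X2 \<Longrightarrow> y \<in> X1 \<Longrightarrow> \<alpha> x \<le> \<alpha> y"
    by (rule orientation_preservingE[OF op]) (rule that)
  have bij: "bij_betw \<alpha> Y Y"
    using perm bij_betw_cong[of Y "restr \<alpha>" \<alpha> Y] by (simp add: perms_of_def)
  define f where "f = the_inv_into {1..m} a \<circ> (\<alpha> \<circ> a)"
  have bij_a: "bij_betw a {1..m} Y" using inj_a by (simp add: bij_betw_def Y_eq)
  have bij_f: "bij_betw f {1..m} {1..m}"
    unfolding f_def by (rule bij_betw_trans[OF bij_betw_trans[OF bij_a bij] bij_betw_the_inv_into[OF bij_a]])
  have f_in: "f i \<in> {1..m}" if "i \<in> {1..m}" for i using bij_f that by (rule bij_betw_apply)
  have \<alpha>_a: "\<alpha> (a i) = a (f i)" if "i \<in> {1..m}" for i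
  proof -
    have "\<alpha> (a i) \<in> a ` {1..m}" using bij a_in_Y[OF that] by (auto simp: Y_eq dest: bij_betw_apply)
    then show ?thesis using f_the_inv_into_f[OF inj_a, of "\<alpha> (a i)"] by (simp add: f_def)
  qed
  have f_less: "f i < f j" if "i \<in> {1..m}" "j \<in> {1..m}" "i \<noteq> j" "\<alpha> (a i) \<le> \<alpha> (a j)" for i j
  proof -
    have "f i \<le> f j" using that a_le_iff f_in by (simp add: \<alpha>_a)
    moreover have "f i \<noteq> f j" using that bij_betw_imp_inj_on[OF bij_f] by (auto dest: inj_onD)
    ultimately show ?thesis by simp
  qed
  define D where "D = {i \<in> {1..m}. a i \<in> X1}"
  have D2: "a i \<in> X2" if "i \<in> {1..m}" "i \<notin> D" for i
    using that X12(1) a_in_Y Y_subset by (auto simp: D_def)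
  have down: "i \<in> D" if "i \<in> {1..m}" "j \<in> D" "i \<le> j" for i j
    using that D2[of i] X12(3)[of "a j" "a i"] a_le_iff[of i j] by (force simp: D_def)
  obtain p where p: "p \<le> m" "D = {1..p}"
  proof
    have fin: "finite (insert 0 D)" by (simp add: D_def)
    then have "Max (insert 0 D) \<in> insert 0 D" by (rule Max_in) simp
    then show "Max (insert 0 D) \<le> m" by (auto simp: D_def)
    show "D = {1..Max (insert 0 D)}"
    proof (intro equalityI subsetI)
      show "i \<in> {1..Max (insert 0 D)}" if "i \<in> D" for i
        using that Max_ge[OF fin, of i] by (auto simp: D_def)
      show "i \<in> D" if "i \<in> {1..Max (insert 0 D)}" for i
        using that down[of i "Max (insert 0 D)"] \<open>Max (insert 0 D) \<in> insert 0 D\<close>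
          \<open>Max (insert 0 D) \<le> m\<close> by auto
    qed
  qed
  have less_same: "f i < f j" if "i \<in> {1..m}" "j \<in> {1..m}" "i < j" "i \<in> D \<longleftrightarrow> j \<in> D" for i j
  proof (rule f_less)
    have "a i \<le> a j" using that by (simp add: a_le_iff)
    then show "\<alpha> (a i) \<le> \<alpha> (a j)"
      using that m1[of "a i" "a j"] m2[of "a i" "a j"] D2[of i] D2[of j] by (auto simp: D_def)
  qed (use that in auto)
  have less_diff: "f i < f j" if "i \<in> {1..m}" "j \<in> D" "i \<notin> D" for i j
    using that m21[of "a i" "a j"] D2[of i] by (intro f_less) (auto simp: D_def)
  \<comment> \<open>A value of a bijection of \<open>{1..m}\<close> counts the arguments with values up to it.\<close>
  have f_count: "f i = card {j \<in> {1..m}. f j \<le> f i}" if "i \<in> {1..m}" for i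
  proof -
    have inj: "inj_on f {j \<in> {1..m}. f j \<le> f i}"
      using bij_betw_imp_inj_on[OF bij_f] by (rule inj_on_subset) auto
    have "f ` {j \<in> {1..m}. f j \<le> f i} = {1..f i}"
    proof
      show "f ` {j \<in> {1..m}. f j \<le> f i} \<subseteq> {1..f i}"
        using f_in by (intro image_subsetI) simp
      show "{1..f i} \<subseteq> f ` {j \<in> {1..m}. f j \<le> f i}"
      proof
        fix v assume v: "v \<in> {1..f i}"
        then have "v \<in> f ` {1..m}" using f_in[OF that] unfolding bij_betw_imp_surj_on[OF bij_f] by simp
        then obtain j where "v = f j" "j \<in> {1..m}" by (rule imageE)
        then show "v \<in> f ` {j \<in> {1..m}. f j \<le> f i}" using v by simp
      qed
    qed
    then show ?thesis using card_image[OF inj] by simp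
  qed
  \<comment> \<open>The exponent \<open>2 * m - p\<close> is \<open>m - p\<close> modulo \<open>m\<close>, but positive even for \<open>p = m\<close>.\<close>
  have f_val: "f i = (i - 1 + (2 * m - p)) mod m + 1" if i: "i \<in> {1..m}" for i
  proof (cases "i \<le> p")
    case True
    have "{j \<in> {1..m}. f j \<le> f i} = {p<..m} \<union> {1..i}"
    proof (intro equalityI subsetI)
      fix j assume j: "j \<in> {j \<in> {1..m}. f j \<le> f i}"
      show "j \<in> {p<..m} \<union> {1..i}"
        using less_same[of i j] j i True p by (force simp: not_le)
    next
      fix j assume "j \<in> {p<..m} \<union> {1..i}"
      then consider "j \<in> {p<..m}" | "j \<in> {1..i}" "j < i" | "j = i" using True by fastforce
      then show "j \<in> {j \<in> {1..m}. f j \<le> f i}"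
        using less_diff[of j i] less_same[of j i] i True p by cases auto
    qed
    moreover have "card ({p<..m} \<union> {1..i}) = (m - p) + i"
      using True by (subst card_Un_disjoint) auto
    moreover have "(i - 1 + (2 * m - p)) mod m = m - p + i - 1"
    proof -
      have "i - 1 + (2 * m - p) = (m - p + i - 1) + m" using True i p by auto
      moreover have "m - p + i - 1 < m" using True i p by auto
      ultimately show ?thesis by simp
    qed
    ultimately show ?thesis using f_count[OF i] i by simp
  next
    case False
    have "{j \<in> {1..m}. f j \<le> f i} = {p<..i}"
    proof (intro equalityI subsetI)
      fix j assume j: "j \<in> {j \<in> {1..m}. f j \<le> f i}"
      show "j \<in> {p<..i}"
        using less_same[of i j] less_diff[of i j] j i False p by (force simp: not_le)
    next
      fix j assume "j \<in> {p<..i}"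
      then consider "j \<in> {p<..i}" "j < i" | "j = i" by fastforce
      then show "j \<in> {j \<in> {1..m}. f j \<le> f i}"
        using less_same[of j i] i False p by cases auto
    qed
    moreover have "(i - 1 + (2 * m - p)) mod m = i - p - 1"
    proof -
      have "i - 1 + (2 * m - p) = (i - p - 1) + m * 2" using False i p by auto
      moreover have "i - p - 1 < m" using i False by auto
      ultimately show ?thesis by simp
    qed
    ultimately show ?thesis using f_count[OF i] False by simp
  qed
  have "1 \<le> 2 * m - p" using p m_gt_1 by simp
  from cyc_powers[OF this] obtain \<tau> where \<tau>: "\<tau> \<in> gen_subsemigroup (tmult Y) {cyc}"
    "\<And>i. i \<in> {1..m} \<Longrightarrow> \<tau> (a i) = a ((i - 1 + (2 * m - p)) mod m + 1)" by blast
  have "gen_subsemigroup (tmult Y) {cyc} \<subseteq> Y \<rightarrow>\<^sub>E Y"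
    by (rule gen_subsemigroup_subset) (use cyc_in in \<open>auto simp: tmult_def compose_def PiE_iff\<close>)
  then have "\<tau> \<in> extensional Y" using \<tau>(1) by (auto simp: PiE_iff)
  then have "restr \<alpha> = \<tau>"
    by (intro extensionalityI[of _ Y]) (auto elim!: in_YE simp: \<alpha>_a f_val \<tau>(2) a_in_Y)
  then show ?thesis using \<tau>(1) by simp
qed

section \<open>Relative generating sets\<close>

lemma perm_factor_of_equal_kernels:
  assumes \<alpha>: "\<alpha> \<in> X \<rightarrow>\<^sub>E Y" "\<alpha> ` X = Y" and \<beta>: "\<beta> \<in> X \<rightarrow>\<^sub>E Y" "\<beta> ` X = Y"
    and ker: "ker_part X \<alpha> = ker_part X \<beta>"
  obtains \<sigma> where "\<sigma> \<in> perms_of Y" "\<And>x. x \<in> X \<Longrightarrow> \<sigma> (\<beta> x) = \<alpha> x"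
proof
  define \<sigma> where "\<sigma> = (\<lambda>y\<in>Y. \<alpha> (inv_into X \<beta> y))"
  have inv: "inv_into X \<beta> (\<beta> x) \<in> X" "\<beta> (inv_into X \<beta> (\<beta> x)) = \<beta> x" if "x \<in> X" for x
    using that by (auto intro: inv_into_into f_inv_into_f)
  show *: "\<sigma> (\<beta> x) = \<alpha> x" if "x \<in> X" for x
    using that inv[OF that] ker \<beta>(2) unfolding ker_part_cong_iff \<sigma>_def by auto
  have "\<sigma> ` Y = (\<sigma> \<circ> \<beta>) ` X" using \<beta>(2) by auto
  also have "\<dots> = \<alpha> ` X" using * by (intro image_cong) auto
  finally have "\<sigma> ` Y = Y" using \<alpha>(2) by simp
  then have "bij_betw \<sigma> Y Y"
    using eq_card_imp_inj_on[OF finite_Y, of \<sigma>] by (simp add: bij_betw_def)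
  then show "\<sigma> \<in> perms_of Y"
    by (auto simp: perms_of_def full_trans_def \<sigma>_def dest: bij_betw_apply)
qed

text \<open>
  Counting shows that in a product with image \<open>Y\<close> the first factor already has image \<open>Y\<close> and the second
  is injective on \<open>Y\<close>. So the kernel is inherited from the first factor, down to a single generator.
\<close>
lemma kernel_of_full_rank_product:
  assumes G: "G \<subseteq> X \<rightarrow>\<^sub>E Y" and "\<delta> \<in> gen_subsemigroup (tmult X) G" "\<delta> ` X = Y"
  shows "\<exists>\<gamma>\<in>G. \<gamma> ` X = Y \<and> ker_part X \<gamma> = ker_part X \<delta>"
  using assms(2,3)
proof induction
  case (gen \<delta>)
  then show ?case by auto
next
  case (mult \<alpha> \<beta>)
  have \<alpha>: "\<alpha> ` X \<subseteq> Y" using subsetD[OF gen_subset[OF G] mult.hyps(1)] by auto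
  have "\<beta> ` (\<alpha> ` X) = Y" using mult.prems by (auto simp: tmult_def compose_def image_image)
  then have "card Y \<le> card (\<alpha> ` X)" using card_image_le[of "\<alpha> ` X" \<beta>] finite_X by simp
  then have \<alpha>Y: "\<alpha> ` X = Y" using \<alpha> finite_Y by (simp add: card_seteq)
  then have "inj_on \<beta> Y"
    using \<open>\<beta> ` (\<alpha> ` X) = Y\<close> by (intro eq_card_imp_inj_on finite_Y) simp
  then have "ker_part X \<alpha> = ker_part X (tmult X \<alpha> \<beta>)"
    unfolding ker_part_cong_iff using \<alpha> by (auto simp: tmult_def compose_def dest: inj_onD)
  then show ?case using mult.IH(1) \<alpha>Y by simp
qed

text \<open>
  Kernels in \<open>\<R>\<^sub>m\<close> cannot be contributed by orientation-preserving generators, and permutations of \<open>Y\<close>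
  receive nothing from them beyond powers of the cycle.
\<close>
lemma relative_generation_necessary:
  assumes B: "B \<subseteq> X \<rightarrow>\<^sub>E Y"
    and gen: "gen_subsemigroup (tmult X) (op_trans_into X Y \<union> B) = X \<rightarrow>\<^sub>E Y"
  shows "R_partitions n m \<subseteq> ker_part X ` B"
    and "perms_of Y \<subseteq> gen_subsemigroup (tmult Y) (restr ` B \<union> {cyc})"
proof -
  let ?G = "op_trans_into X Y \<union> B"
  have G: "?G \<subseteq> X \<rightarrow>\<^sub>E Y" using B op_subset by simp
  show "R_partitions n m \<subseteq> ker_part X ` B"
  proof
    fix P assume P: "P \<in> R_partitions n m"
    then have part: "partition_on X P" and card: "card P = m"
      and not_op: "P \<notin> Q_partitions n m \<union> P_partitions n m"
      by (auto simp: R_partitions_def X_eq)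
    have "finite P" using finite_elements[OF finite_X part] .
    then obtain A where "bij_betw A {1..m} P" using ex_bij_betw_nat_finite_1 card by blast
    then obtain \<alpha> where \<alpha>: "\<alpha> \<in> X \<rightarrow>\<^sub>E Y" "ker_part X \<alpha> = P"
      using map_with_listed_kernel[OF part _ inj_a] Y_eq by metis
    have "card (\<alpha> ` X) = card Y" using \<alpha>(2) card card_Y card_ker_part by metis
    then have "\<alpha> ` X = Y" using \<alpha>(1) finite_Y by (intro card_subset_eq) auto
    then obtain \<gamma> where \<gamma>: "\<gamma> \<in> ?G" "\<gamma> ` X = Y" "ker_part X \<gamma> = P"
      using kernel_of_full_rank_product[OF G, of \<alpha>] gen \<alpha> by auto
    have "\<gamma> \<notin> op_trans_into X Y"
    proof
      assume "\<gamma> \<in> op_trans_into X Y"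
      then have "orientation_preserving {1..n} \<gamma>" by (simp add: op_trans_into_def X_eq)
      moreover have "1 \<le> n" using X_nonempty by (auto simp: X_eq)
      ultimately show False
        using ker_part_orientation_preserving[of n \<gamma> m] not_op \<gamma> card_Y by (simp add: X_eq)
    qed
    then show "P \<in> ker_part X ` B" using \<gamma> by auto
  qed
  show "perms_of Y \<subseteq> gen_subsemigroup (tmult Y) (restr ` B \<union> {cyc})"
  proof
    fix \<sigma> assume \<sigma>: "\<sigma> \<in> perms_of Y"
    \<comment> \<open>Any extension of \<open>\<sigma>\<close> to \<open>X\<close> with values in \<open>Y\<close> serves; the value \<open>a 1\<close> is arbitrary.\<close>
    define \<alpha> where "\<alpha> = (\<lambda>x\<in>X. if x \<in> Y then \<sigma> x else a 1)"
    have "\<alpha> \<in> X \<rightarrow>\<^sub>E Y"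
      using \<sigma> a_in_Y[of 1] m_gt_1 by (auto simp: \<alpha>_def perms_of_def full_trans_def)
    moreover have "restr \<alpha> = \<sigma>"
      using \<sigma> Y_subset
      by (auto simp: \<alpha>_def fun_eq_iff perms_of_def full_trans_def PiE_iff extensional_def)
    ultimately have "\<sigma> \<in> gen_subsemigroup (tmult Y) (restr ` ?G)"
      unfolding gen_restr[OF G] gen by auto
    moreover have "restr ` ?G \<subseteq> full_trans Y"
      unfolding full_trans_def by (rule image_subsetI, rule restr_closed, rule subsetD[OF G])
    ultimately have "\<sigma> \<in> gen_subsemigroup (tmult Y) (restr ` ?G \<inter> perms_of Y)"
      using permutation_products_use_permutation_generators[OF finite_Y] \<sigma> by blast
    moreover have "restr ` ?G \<inter> perms_of Y \<subseteq> gen_subsemigroup (tmult Y) (restr ` B \<union> {cyc})"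
    proof
      fix \<tau> assume "\<tau> \<in> restr ` ?G \<inter> perms_of Y"
      then consider \<beta> where "\<beta> \<in> B" "\<tau> = restr \<beta>"
        | \<beta> where "\<beta> \<in> op_trans_into X Y" "\<tau> = restr \<beta>" "restr \<beta> \<in> perms_of Y" by auto
      then show "\<tau> \<in> gen_subsemigroup (tmult Y) (restr ` B \<union> {cyc})"
      proof cases
        case 1 then show ?thesis by (auto intro: gen_subsemigroup.gen)
      next
        case 2
        have "gen_subsemigroup (tmult Y) {cyc} \<subseteq> gen_subsemigroup (tmult Y) (restr ` B \<union> {cyc})"
          by (rule gen_subsemigroup_mono) (auto intro: gen_subsemigroup.gen)
        then show ?thesis using orientation_preserving_perm_is_cyc_power 2 by blast
      qed
    qed
    ultimately show "\<sigma> \<in> gen_subsemigroup (tmult Y) (restr ` B \<union> {cyc})"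
      using gen_subsemigroup_mono by blast
  qed
qed

text \<open>
  Double transitivity of the permutations of \<open>Y\<close>: it turns the one collapse of \<open>a\<^sub>1\<close> to \<open>a\<^sub>2\<close> into a
  collapse of any point of \<open>Y\<close> to any other.
\<close>
lemma perm_with_two_values:
  assumes "z \<in> Y" "w \<in> Y" "z \<noteq> w"
  obtains \<tau> where "\<tau> \<in> perms_of Y" "\<tau> (a 1) = z" "\<tau> (a 2) = w"
proof -
  have m12: "1 \<in> {1..m}" "2 \<in> {1..m}" using m_gt_1 by simp_all
  have a12: "a 1 \<in> Y" "a 2 \<in> Y" using a_in_Y m12 by blast+
  have a12_ne: "a 1 \<noteq> a 2" using a_eq_iff[OF m12] by simp
  \<comment> \<open>The transposition of \<open>a 1\<close> and \<open>z\<close> sends \<open>w'\<close> to \<open>w\<close>, so \<open>a 2\<close> has to be moved to \<open>w'\<close> first.\<close>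
  define w' where "w' = transpose (a 1) z w"
  have invol: "transpose (a 1) z w' = w" by (simp add: w'_def)
  then have w'_ne: "w' \<noteq> a 1" using assms(3) by (metis transpose_apply_first)
  have "w' \<in> transpose (a 1) z ` Y" unfolding w'_def using assms(2) by (rule imageI)
  then have w': "w' \<in> Y" using assms(1) a12(1) by simp
  define f where "f = transpose (a 1) z \<circ> transpose (a 2) w'"
  have f: "f (a 1) = z" "f (a 2) = w" using a12_ne w'_ne invol by (simp_all add: f_def)
  have "f ` Y = transpose (a 1) z ` transpose (a 2) w' ` Y" by (simp add: f_def image_comp)
  also have "\<dots> = Y" using assms(1) a12 w' by simp
  finally have "f ` Y = Y" .
  then have "bij_betw f Y Y"
    using eq_card_imp_inj_on[OF finite_Y, of f] by (simp add: bij_betw_def)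
  then have "bij_betw (restrict f Y) Y Y"
    using bij_betw_cong[of Y "restrict f Y" f Y] by simp
  then have "restrict f Y \<in> perms_of Y"
    using \<open>f ` Y = Y\<close> by (auto simp: perms_of_def full_trans_def)
  then show thesis by (rule that) (use f a12 in simp_all)
qed

text \<open>
  Maps with image \<open>Y\<close> are obtained from a generator with the right kernel by permuting values.
  If \<open>\<alpha>\<close> misses a value \<open>z\<close> in \<open>Y\<close>, it is not injective, say \<open>\<alpha> x1 = \<alpha> x2\<close>. Giving \<open>x1\<close> the value \<open>z\<close>
  instead raises the rank by one, and collapsing \<open>z\<close> to \<open>\<alpha> x2\<close> afterwards restores \<open>\<alpha>\<close>.
\<close>
lemma relative_generation_sufficient:
  assumes B: "B \<subseteq> X \<rightarrow>\<^sub>E Y" and R: "R_partitions n m \<subseteq> ker_part X ` B"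
    and perms: "perms_of Y \<subseteq> gen_subsemigroup (tmult Y) (restr ` B \<union> {cyc})"
  shows "gen_subsemigroup (tmult X) (op_trans_into X Y \<union> B) = X \<rightarrow>\<^sub>E Y"
proof -
  let ?G = "op_trans_into X Y \<union> B"
  define M where "M = gen_subsemigroup (tmult X) ?G"
  have G: "?G \<subseteq> X \<rightarrow>\<^sub>E Y" using B op_subset by simp
  have M: "M \<subseteq> X \<rightarrow>\<^sub>E Y" unfolding M_def by (rule gen_subset[OF G])
  have M_mult: "tmult X \<alpha> \<beta> \<in> M" if "\<alpha> \<in> M" "\<beta> \<in> M" for \<alpha> \<beta>
    using that by (simp add: M_def gen_subsemigroup.mult)
  have G_M: "?G \<subseteq> M" by (auto simp: M_def intro: gen_subsemigroup.gen)
  have "gen_subsemigroup (tmult Y) (restr ` B \<union> {cyc}) \<subseteq> gen_subsemigroup (tmult Y) (restr ` ?G)"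
    using cyc_in_restr_op by (intro gen_subsemigroup_mono) (auto intro!: gen_subsemigroup.gen)
  then have perms_M: "perms_of Y \<subseteq> restr ` M"
    using perms by (simp add: gen_restr[OF G] M_def)
  have a12: "a 1 \<in> Y" "a 2 \<in> Y" "a 1 < a 2"
    using a_in_Y[of 1] a_in_Y[of 2] a_less_iff[of 1 2] m_gt_1 by auto
  \<comment> \<open>The collapse of \<open>a 1\<close> to \<open>a 2\<close> is monotone, hence available as an orientation-preserving map.\<close>
  define \<epsilon> where "\<epsilon> = (\<lambda>y\<in>Y. if y = a 1 then a 2 else y)"
  have a2_le: "a 2 \<le> y" if "y \<in> Y" "y \<noteq> a 1" for y
  proof -
    obtain i where "i \<in> {1..m}" "y = a i" using \<open>y \<in> Y\<close> by (rule in_YE)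
    moreover then have "i \<noteq> 1" using that by auto
    ultimately show ?thesis using a_le_iff[of 2 i] m_gt_1 by auto
  qed
  have a1_le: "a 1 \<le> y" if "y \<in> Y" for y
    using a2_le[OF that] a12 by (cases "y = a 1") auto
  have "orientation_preserving Y \<epsilon>"
  proof (rule monotone_orientation_preserving)
    show "Y \<noteq> {}" using a12 by auto
    show "\<epsilon> x \<le> \<epsilon> y" if "x \<in> Y" "y \<in> Y" "x \<le> y" for x y
      using that a2_le a1_le by (force simp: \<epsilon>_def)
  qed
  moreover have "\<epsilon> \<in> Y \<rightarrow>\<^sub>E Y" using a12 by (auto simp: \<epsilon>_def)
  ultimately obtain \<epsilon>' where "\<epsilon>' \<in> op_trans_into X Y" "restr \<epsilon>' = \<epsilon>"
    using orientation_preserving_extension[of \<epsilon>] by blast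
  then have \<epsilon>'_M: "\<epsilon>' \<in> M" and \<epsilon>'_Y: "\<epsilon>' y = (if y = a 1 then a 2 else y)" if "y \<in> Y" for y
    using G_M that by (auto simp: \<epsilon>_def fun_eq_iff split: if_splits)
  have "\<alpha> \<in> M" if "\<alpha> \<in> X \<rightarrow>\<^sub>E Y" for \<alpha>
    using that
  proof (induction "m - card (\<alpha> ` X)" arbitrary: \<alpha> rule: less_induct)
    case (less \<alpha>)
    have \<alpha>Y: "\<alpha> ` X \<subseteq> Y" using less.prems by auto
    show ?case
    proof (cases "\<alpha> ` X = Y")
      case True
      define P where "P = ker_part X \<alpha>"
      have "card P = m" using True card_Y by (simp add: P_def card_ker_part)
      obtain \<beta> where \<beta>: "\<beta> \<in> M" "ker_part X \<beta> = P"
      proof (cases "P \<in> Q_partitions n m \<union> P_partitions n m")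
        case True
        then obtain \<beta> where "\<beta> \<in> X \<rightarrow>\<^sub>E Y" "ker_part X \<beta> = P" "orientation_preserving X \<beta>"
          using orientation_preserving_with_kernel[OF True m_gt_1 a_mono] X_eq Y_eq by metis
        moreover then have "\<beta> \<in> op_trans_into X Y" by (simp add: op_trans_into_def trans_into_eq)
        ultimately show thesis using that G_M by blast
      next
        case False
        then have "P \<in> R_partitions n m"
          using \<open>card P = m\<close> partition_on_ker_part[of X \<alpha>] by (simp add: R_partitions_def P_def X_eq)
        then obtain \<beta> where "\<beta> \<in> B" "ker_part X \<beta> = P" using R by blast
        then show thesis using that G_M by blast
      qed
      have "\<beta> \<in> X \<rightarrow>\<^sub>E Y" using \<beta>(1) M by blast
      moreover have "card (\<beta> ` X) = card Y"
        using \<beta>(2) card_ker_part[of X \<beta>] \<open>card P = m\<close> card_Y by simp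
      ultimately have "\<beta> ` X = Y" using finite_Y by (intro card_subset_eq) auto
      then obtain \<sigma> where \<sigma>: "\<sigma> \<in> perms_of Y" "\<And>x. x \<in> X \<Longrightarrow> \<sigma> (\<beta> x) = \<alpha> x"
        using perm_factor_of_equal_kernels[OF less.prems True \<open>\<beta> \<in> X \<rightarrow>\<^sub>E Y\<close>] \<beta>(2) P_def by metis
      obtain \<gamma> where \<gamma>: "\<gamma> \<in> M" "\<sigma> = restr \<gamma>" using \<sigma>(1) perms_M by blast
      have "\<gamma> (\<beta> x) = \<alpha> x" if "x \<in> X" for x
        using \<sigma>(2)[OF that] \<gamma>(2) \<open>\<beta> ` X = Y\<close> that by auto
      then have "\<alpha> = tmult X \<beta> \<gamma>"
        using less.prems by (intro extensionalityI[of _ X]) (auto simp: tmult_def compose_def PiE_iff)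
      then show ?thesis using M_mult[OF \<beta>(1) \<gamma>(1)] by simp
    next
      case False
      then have "card (\<alpha> ` X) < card Y" using \<alpha>Y finite_Y by (simp add: psubset_card_mono psubset_eq)
      moreover have "card Y \<le> card X" using Y_subset finite_X by (simp add: card_mono)
      ultimately have "\<not> inj_on \<alpha> X" using card_image[of \<alpha> X] by auto
      then obtain x1 x2 where x: "x1 \<in> X" "x2 \<in> X" "x1 \<noteq> x2" "\<alpha> x1 = \<alpha> x2"
        by (auto simp: inj_on_def)
      obtain z where z: "z \<in> Y" "z \<notin> \<alpha> ` X" using False \<alpha>Y by auto
      have "\<alpha> x2 \<in> Y" "z \<noteq> \<alpha> x2" using \<alpha>Y x(2) z by auto
      then obtain \<tau> where \<tau>: "\<tau> \<in> perms_of Y" "\<tau> (a 1) = z" "\<tau> (a 2) = \<alpha> x2"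
        using perm_with_two_values z(1) by metis
      then have bij: "bij_betw \<tau> Y Y" by (simp add: perms_of_def)
      define \<rho> where "\<rho> = inv_into Y \<tau>"
      have \<rho>: "\<rho> y \<in> Y" "\<tau> (\<rho> y) = y" if "y \<in> Y" for y
        using that bij by (auto simp: \<rho>_def bij_betw_def intro: inv_into_into f_inv_into_f)
      have \<rho>\<tau>: "\<rho> (\<tau> y) = y" if "y \<in> Y" for y
        using that bij by (simp add: \<rho>_def bij_betw_def)
      have \<rho>_x2: "\<rho> (\<alpha> x2) = a 2" using \<rho>\<tau>[OF a12(2)] \<tau>(3) by simp
      have \<rho>_ne: "\<rho> (\<alpha> x) \<noteq> a 1" if "x \<in> X" for x
        using \<rho>(2)[of "\<alpha> x"] \<tau>(2) z(2) \<alpha>Y that by auto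
      \<comment> \<open>Read through \<open>\<tau>\<close>, the value \<open>a 1\<close> stands for \<open>z\<close> and \<open>a 2\<close> for the common value at \<open>x1\<close>
        and \<open>x2\<close>.\<close>
      define \<beta> where "\<beta> = (\<lambda>x\<in>X. if x = x1 then a 1 else \<rho> (\<alpha> x))"
      have \<beta>: "\<beta> \<in> X \<rightarrow>\<^sub>E Y" using \<rho>(1) \<alpha>Y a12(1) by (auto simp: \<beta>_def)
      have "\<beta> ` X = insert (a 1) (\<rho> ` \<alpha> ` X)"
      proof (intro equalityI subsetI)
        show "y \<in> insert (a 1) (\<rho> ` \<alpha> ` X)" if "y \<in> \<beta> ` X" for y
          using that by (auto simp: \<beta>_def)
        show "y \<in> \<beta> ` X" if y: "y \<in> insert (a 1) (\<rho> ` \<alpha> ` X)" for y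
        proof -
          from y consider "y = a 1" | x where "x \<in> X" "y = \<rho> (\<alpha> x)" by blast
          then consider "y = a 1" | x where "x \<in> X" "x \<noteq> x1" "y = \<rho> (\<alpha> x)" | "y = \<rho> (\<alpha> x2)"
          proof cases
            case (2 x)
            then show thesis using that(2)[of x] that(3) x(4) by (cases "x = x1") auto
          qed (rule that(1))
          then show ?thesis
          proof cases
            case 1 then show ?thesis using x(1) by (auto simp: \<beta>_def image_iff intro!: bexI[of _ x1])
          next
            case (2 x) then show ?thesis by (auto simp: \<beta>_def image_iff intro!: bexI[of _ x])
          next
            case 3 then show ?thesis using x by (auto simp: \<beta>_def image_iff intro!: bexI[of _ x2])
          qed
        qed
      qed
      moreover have "a 1 \<notin> \<rho> ` \<alpha> ` X" using \<rho>_ne by force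
      moreover have "card (\<rho> ` \<alpha> ` X) = card (\<alpha> ` X)"
        using \<rho>(2) \<alpha>Y by (intro card_image inj_on_inverseI[of _ \<tau>]) auto
      ultimately have "card (\<beta> ` X) = Suc (card (\<alpha> ` X))" using finite_X by simp
      then have "m - card (\<beta> ` X) < m - card (\<alpha> ` X)" using \<open>card (\<alpha> ` X) < card Y\<close> card_Y by simp
      then have "\<beta> \<in> M" using less.hyps \<beta> by blast
      obtain \<tau>' where \<tau>': "\<tau>' \<in> M" "\<tau> = restr \<tau>'" using \<tau>(1) perms_M by blast
      have "\<tau>' (\<epsilon>' (\<beta> x)) = \<alpha> x" if "x \<in> X" for x
      proof (cases "x = x1")
        case True
        then have "\<epsilon>' (\<beta> x) = a 2" using that \<epsilon>'_Y[OF a12(1)] by (simp add: \<beta>_def)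
        then show ?thesis using \<tau>(3) \<tau>'(2) a12(2) True x(4) by simp
      next
        case False
        have "\<rho> (\<alpha> x) \<in> Y" "\<tau> (\<rho> (\<alpha> x)) = \<alpha> x" using \<rho> \<alpha>Y that by auto
        then show ?thesis using False that \<epsilon>'_Y[of "\<rho> (\<alpha> x)"] \<rho>_ne[OF that] \<tau>'(2) by (simp add: \<beta>_def)
      qed
      moreover have "\<epsilon>' (\<beta> x) \<in> X" "\<beta> x \<in> X" if "x \<in> X" for x
      proof -
        have "\<beta> x \<in> Y" using \<beta> that by auto
        then show "\<beta> x \<in> X" using Y_subset by auto
        then show "\<epsilon>' (\<beta> x) \<in> X" using \<epsilon>'_Y[OF \<open>\<beta> x \<in> Y\<close>] a12(2) Y_subset by auto
      qed
      ultimately have "\<alpha> = tmult X (tmult X \<beta> \<epsilon>') \<tau>'"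
        using less.prems by (intro extensionalityI[of _ X]) (auto simp: tmult_def compose_def PiE_iff)
      then show ?thesis using M_mult \<open>\<beta> \<in> M\<close> \<epsilon>'_M[OF a12(1)] \<tau>'(1) by simp
    qed
  qed
  then show ?thesis using M unfolding M_def by blast
qed

theorem rel_generating_set_iff:
  assumes "B \<subseteq> trans_into X Y"
  shows "rel_generating_set (tmult X) (trans_into X Y) (op_trans_into X Y) B \<longleftrightarrow>
    R_partitions n m \<subseteq> ker_part X ` B \<and>
    perms_of Y \<subseteq> gen_subsemigroup (tmult Y) (restr ` B \<union> {cyc})"
  using assms relative_generation_necessary[of B] relative_generation_sufficient[of B]
  unfolding rel_generating_set_def trans_into_eq by blast

end

section \<open>Minimality\<close>

text \<open>
  The counting argument concerns any finite set \<open>B\<close> with a labelling \<open>k\<close> (the kernels), labels \<open>R\<close> that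
  have to be hit, and a further monotone requirement \<open>g\<close>. In a minimal \<open>B\<close>, choose one element for each
  label in \<open>R\<close>; an element sharing its label with an unchosen one is never needed for covering \<open>R\<close>.
  Conversely, the cardinality condition makes \<open>k\<close> a bijection from \<open>B - Bt\<close> onto \<open>R\<close>. Hence removing
  an element whose label does not occur in \<open>Bt\<close> uncovers a label, and removing any other violates \<open>g\<close>.
\<close>
lemma minimal_covering_family_iff:
  assumes fin: "finite B" and mono: "\<And>C D. C \<subseteq> D \<Longrightarrow> D \<subseteq> B \<Longrightarrow> g C \<Longrightarrow> g D"
  shows "((R \<subseteq> k ` B \<and> g B) \<and> (\<forall>C. C \<subset> B \<longrightarrow> \<not> (R \<subseteq> k ` C \<and> g C))) \<longleftrightarrow>
    (\<exists>Bt\<subseteq>B. R \<subseteq> k ` (B - Bt) \<and> card (B - Bt) = card R \<and> g B \<and>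
      (\<forall>\<gamma>\<in>B. k \<gamma> \<in> k ` Bt \<longrightarrow> \<not> g (B - {\<gamma>})))" (is "?minimal \<longleftrightarrow> ?split")
proof
  assume min: ?minimal
  then obtain B0 where B0: "B0 \<subseteq> B" "inj_on k B0" "k ` B0 = R"
    using subset_image_inj[of R k B] by auto
  have "\<not> g (B - {\<gamma>})" if \<gamma>: "\<gamma> \<in> B" "k \<gamma> \<in> k ` (B - B0)" for \<gamma>
  proof -
    obtain \<delta> where \<delta>: "\<delta> \<in> B - B0" "k \<gamma> = k \<delta>" using \<gamma> by blast
    have "R \<subseteq> k ` (B - {\<gamma>})"
    proof
      fix K assume "K \<in> R"
      then obtain \<beta> where "\<beta> \<in> B0" "k \<beta> = K" using B0 by blast
      then show "K \<in> k ` (B - {\<gamma>})" using \<delta> B0(1) by (cases "\<beta> = \<gamma>") force+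
    qed
    then show ?thesis using min \<gamma>(1) by blast
  qed
  moreover have "B - (B - B0) = B0" using B0 by auto
  moreover have "card B0 = card R" using B0 card_image by metis
  ultimately show ?split using min B0(3) by (intro exI[of _ "B - B0"]) auto
next
  assume ?split
  then obtain Bt where Bt: "Bt \<subseteq> B" "R \<subseteq> k ` (B - Bt)" "card (B - Bt) = card R" "g B"
    and tight: "\<And>\<gamma>. \<gamma> \<in> B \<Longrightarrow> k \<gamma> \<in> k ` Bt \<Longrightarrow> \<not> g (B - {\<gamma>})" by auto
  have finBt: "finite (B - Bt)" using fin by simp
  have "card (k ` (B - Bt)) \<le> card R" using card_image_le[OF finBt] Bt(3) by simp
  then have R: "R = k ` (B - Bt)" using Bt(2) finBt by (intro card_seteq) auto
  then have inj: "inj_on k (B - Bt)" using Bt(3) finBt by (intro eq_card_imp_inj_on) auto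
  have "\<not> (R \<subseteq> k ` C \<and> g C)" if C: "C \<subset> B" for C
  proof
    assume RC: "R \<subseteq> k ` C \<and> g C"
    obtain \<gamma> where \<gamma>: "\<gamma> \<in> B" "\<gamma> \<notin> C" using C by auto
    then have "g (B - {\<gamma>})" using mono[of C "B - {\<gamma>}"] C RC by blast
    then have notin: "k \<gamma> \<notin> k ` Bt" using tight \<gamma>(1) by blast
    then have "\<gamma> \<in> B - Bt" using \<gamma>(1) by blast
    then have "k \<gamma> \<in> k ` C" using R RC by blast
    then obtain \<delta> where \<delta>: "\<delta> \<in> C" "k \<delta> = k \<gamma>" by force
    have "\<delta> \<notin> Bt" using notin imageI[of \<delta> Bt k] \<delta>(2) by auto
    then have "\<delta> \<in> B - Bt" using C \<delta>(1) by auto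
    then have "\<delta> = \<gamma>" using inj \<delta> \<open>\<gamma> \<in> B - Bt\<close> by (auto dest: inj_onD)
    then show False using \<delta> \<gamma> by simp
  qed
  then show ?minimal using Bt by blast
qed

theorem theorem14:
  fixes n m :: nat and a :: "nat \<Rightarrow> nat" and X Y :: "nat set" and B :: "(nat \<Rightarrow> nat) set"
  assumes "X = {1..n}"
    and "1 < m" and "m \<le> n"
    and "strict_mono_on {1..m} a" and "Y = a ` {1..m}" and "Y \<subseteq> X"
    and "B \<subseteq> trans_into X Y"
  shows "minimal_rel_generating_set (tmult X) (trans_into X Y) (op_trans_into X Y) B \<longleftrightarrow>
    (\<exists>Bt. Bt \<subseteq> B \<and>
       R_partitions n m \<subseteq> ker_part X ` (B - Bt) \<and>
       card (B - Bt) = card (R_partitions n m) \<and>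
       perms_of Y \<subseteq>
         gen_subsemigroup (tmult Y) ((\<lambda>\<beta>. restrict \<beta> Y) ` B \<union> {cyclic_perm m a}) \<and>
       (\<forall>\<gamma>\<in>B. ker_part X \<gamma> \<in> ker_part X ` Bt \<longrightarrow>
          \<not> perms_of Y \<subseteq>
            gen_subsemigroup (tmult Y) ((\<lambda>\<beta>. restrict \<beta> Y) ` (B - {\<gamma>}) \<union> {cyclic_perm m a})))"
proof -
  interpret chain_with_range n m a X Y by unfold_locales (use assms in auto)
  let ?R = "R_partitions n m"
  let ?g = "\<lambda>C. perms_of Y \<subseteq> gen_subsemigroup (tmult Y) (restr ` C \<union> {cyc})"
  have "finite (X \<rightarrow>\<^sub>E Y)" using finite_X finite_Y by (simp add: finite_PiE)
  then have fin: "finite B" using assms(7) finite_subset by (auto simp: trans_into_eq)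
  have mono: "?g D" if "C \<subseteq> D" "?g C" for C D
  proof -
    have "gen_subsemigroup (tmult Y) (restr ` C \<union> {cyc})
        \<subseteq> gen_subsemigroup (tmult Y) (restr ` D \<union> {cyc})"
      using that(1) by (intro gen_subsemigroup_mono) (auto intro!: gen_subsemigroup.gen)
    then show ?thesis using that(2) by simp
  qed
  have "minimal_rel_generating_set (tmult X) (trans_into X Y) (op_trans_into X Y) B \<longleftrightarrow>
      (?R \<subseteq> ker_part X ` B \<and> ?g B) \<and> (\<forall>C. C \<subset> B \<longrightarrow> \<not> (?R \<subseteq> ker_part X ` C \<and> ?g C))"
    unfolding minimal_rel_generating_set_def rel_generating_set_iff[OF assms(7)]
    using rel_generating_set_iff assms(7) by (metis (no_types, lifting) order_trans psubset_imp_subset)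
  also have "\<dots> \<longleftrightarrow> (\<exists>Bt\<subseteq>B. ?R \<subseteq> ker_part X ` (B - Bt) \<and> card (B - Bt) = card ?R \<and> ?g B \<and>
      (\<forall>\<gamma>\<in>B. ker_part X \<gamma> \<in> ker_part X ` Bt \<longrightarrow> \<not> ?g (B - {\<gamma>})))"
    by (rule minimal_covering_family_iff[OF fin mono])
  finally show ?thesis .
qed

end
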